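(* Let $\mathcal{G}=(\mathcal{V},\mathcal{E})$ be an undirected graph on $n$ vertices with public edge lengths such that every pair of vertices $u,v$ has a unique shortest path $P(u,v)$, and let $w:\mathcal{E}\to\mathbb{R}^{\ge 0}$ be a private attribute function. Let $\gamma(u,v)=\min_{e\in P(u,v)} w(e)$ denote the bottleneck query. For privacy parameters $\varepsilon,\delta\in(0,1)$: (1) there exists an efficient (polynomial-time) $\varepsilon$-differentially private algorithm that outputs estimates $\widetilde\gamma(u,v)$ for all pairs such that with probability at least $1-1/n$, $\max_{u,v}|\widetilde\gamma(u,v)-\gamma(u,v)|=O\!\left(\frac{\log n}{\varepsilon}\right)$; (2) there exists an efficient (polynomial-time) $(\varepsilon,\delta)$-differentially private algorithm that outputs estimates $\widetilde\gamma(u,v)$ for all pairs such that with probability at least $1-1/n$, $\max_{u,v}|\widetilde\gamma(u,v)-\gamma(u,v)|=O\!\left(\frac{\sqrt{\log n\,\log(1/\delta)}}{\varepsilon}\right)$.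
   Context: The shortest paths (determined by the public edge lengths) are public; the attributes $w(e)$ are separate from the edge lengths and do not affect the shortest paths. Two attribute functions $w,w':\mathcal{E}\to\mathbb{R}^{\ge0}$ are neighboring if $\sum_{e\in\mathcal{E}}|w(e)-w'(e)|\le 1$. A randomized algorithm $\mathcal{A}$ taking $(\mathcal{G},w)$ as input is $(\varepsilon,\delta)$-differentially private if for all neighboring $w,w'$ and all sets $C$ of possible outputs, $\Pr[\mathcal{A}(\mathcal{G},w)\in C]\le e^{\varepsilon}\Pr[\mathcal{A}(\mathcal{G},w')\in C]+\delta$; it is $\varepsilon$-differentially private if this holds with $\delta=0$. "With high probability" in the paper means with probability at least $1-1/n$ here.
   Formalization: In (2) the constant in O(·) is uniform only over δ ≤ δ0 for each fixed δ0 < 1 (δ bounded away from 1), since with one absolute constant for all δ in (0,1) the claim is false, e.g. on paths with ε = 1/2 and δ = 1 − n^(−1/2). *)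

theory Defs
  imports "HOL-Probability.Probability" "HOL-Computational_Algebra.Polynomial"
begin

section \<open>Networks, shortest paths and bottleneck queries\<close>

text \<open>A finite simple undirected graph on the vertices \<open>0, \<dots>, n - 1\<close>; an edge is a two-element
  set of vertices. The edge lengths are public; their values outside \<open>edges\<close> are irrelevant.\<close>

record network =
  nverts :: nat
  edges :: "nat set set"
  edge_len :: "nat set \<Rightarrow> real"

definition wf_network :: "network \<Rightarrow> bool" where
  "wf_network G \<longleftrightarrow> 0 < nverts G
     \<and> edges G \<subseteq> {{u, v} |u v. u < nverts G \<and> v < nverts G \<and> u \<noteq> v}
     \<and> (\<forall>e\<in>edges G. 0 \<le> edge_len G e)"

definition path_edges :: "nat list \<Rightarrow> nat set list" where
  "path_edges p = map (\<lambda>(a, b). {a, b}) (zip p (tl p))"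

definition is_path :: "network \<Rightarrow> nat \<Rightarrow> nat \<Rightarrow> nat list \<Rightarrow> bool" where
  "is_path G u v p \<longleftrightarrow> p \<noteq> [] \<and> hd p = u \<and> last p = v \<and> distinct p
     \<and> set p \<subseteq> {..<nverts G} \<and> set (path_edges p) \<subseteq> edges G"

definition path_length :: "network \<Rightarrow> nat list \<Rightarrow> real" where
  "path_length G p = sum_list (map (edge_len G) (path_edges p))"

definition is_shortest_path :: "network \<Rightarrow> nat \<Rightarrow> nat \<Rightarrow> nat list \<Rightarrow> bool" where
  "is_shortest_path G u v p \<longleftrightarrow> is_path G u v p
     \<and> (\<forall>q. is_path G u v q \<longrightarrow> path_length G p \<le> path_length G q)"

definition unique_shortest_paths :: "network \<Rightarrow> bool" where
  "unique_shortest_paths G \<longleftrightarrow>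
     (\<forall>u<nverts G. \<forall>v<nverts G. \<exists>!p. is_shortest_path G u v p)"

definition shortest_path :: "network \<Rightarrow> nat \<Rightarrow> nat \<Rightarrow> nat list" where
  "shortest_path G u v = (THE p. is_shortest_path G u v p)"

definition bottleneck :: "network \<Rightarrow> (nat set \<Rightarrow> real) \<Rightarrow> nat \<Rightarrow> nat \<Rightarrow> real" where
  "bottleneck G w u v = Min (w ` set (path_edges (shortest_path G u v)))"

text \<open>The queried pairs. Diagonal pairs are excluded: the path from a vertex to itself has no
  edges, so its bottleneck is undefined.\<close>

definition vertex_pairs :: "network \<Rightarrow> (nat \<times> nat) set" where
  "vertex_pairs G = {(u, v). u < nverts G \<and> v < nverts G \<and> u \<noteq> v}"

definition attributes :: "network \<Rightarrow> (nat set \<Rightarrow> real) set" where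
  "attributes G = {w. \<forall>e\<in>edges G. 0 \<le> w e}"

definition neighboring :: "network \<Rightarrow> (nat set \<Rightarrow> real) \<Rightarrow> (nat set \<Rightarrow> real) \<Rightarrow> bool" where
  "neighboring G w w' \<longleftrightarrow> (\<Sum>e\<in>edges G. \<bar>w e - w' e\<bar>) \<le> 1"

section \<open>A randomized real RAM\<close>

text \<open>Programs work on two separate memories, one of natural numbers and one of reals, each
  organised into two-dimensional arrays. Following the usual real-RAM conventions, a real operation
  takes unit time, and a real value can influence the natural-number memory only through
  comparisons (there is no rounding). Naturals can only be added and subtracted, so unit cost
  cannot be exploited to build up numbers of superpolynomial bit length. The only program constants
  are integers. Exact draws from the standard Laplace and standard normal distributions are
  primitive.\<close>

datatype noise = Laplace | Gauss

datatype iexp =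
    IConst nat
  | IRead nat iexp iexp
  | IAdd iexp iexp
  | ISub iexp iexp

datatype rexp =
    RConst int
  | RRead nat iexp iexp
  | RAdd rexp rexp
  | RSub rexp rexp
  | RMul rexp rexp
  | RDiv rexp rexp
  | RSqrt rexp
  | RLn rexp

datatype bexp =
    ILess iexp iexp
  | RLess rexp rexp
  | Neg bexp
  | Conj bexp bexp

datatype com =
    Skip
  | IAssign nat iexp iexp iexp
  | RAssign nat iexp iexp rexp
  | Draw noise nat iexp iexp
  | Seq com com
  | Cond bexp com com
  | While bexp com

record state =
  imem :: "nat \<Rightarrow> nat \<Rightarrow> nat \<Rightarrow> nat"
  rmem :: "nat \<Rightarrow> nat \<Rightarrow> nat \<Rightarrow> real"
  draws :: nat

definition store :: "(nat \<Rightarrow> nat \<Rightarrow> nat \<Rightarrow> 'a) \<Rightarrow> nat \<Rightarrow> nat \<Rightarrow> nat \<Rightarrow> 'a \<Rightarrow> (nat \<Rightarrow> nat \<Rightarrow> nat \<Rightarrow> 'a)" where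
  "store m a i j x = m(a := (m a)(i := (m a i)(j := x)))"

primrec ival :: "iexp \<Rightarrow> state \<Rightarrow> nat" where
  "ival (IConst k) s = k"
| "ival (IRead a i j) s = imem s a (ival i s) (ival j s)"
| "ival (IAdd x y) s = ival x s + ival y s"
| "ival (ISub x y) s = ival x s - ival y s"

primrec rval :: "rexp \<Rightarrow> state \<Rightarrow> real" where
  "rval (RConst k) s = of_int k"
| "rval (RRead a i j) s = rmem s a (ival i s) (ival j s)"
| "rval (RAdd x y) s = rval x s + rval y s"
| "rval (RSub x y) s = rval x s - rval y s"
| "rval (RMul x y) s = rval x s * rval y s"
| "rval (RDiv x y) s = rval x s / rval y s"
| "rval (RSqrt x) s = sqrt (rval x s)"
| "rval (RLn x) s = ln (rval x s)"

primrec bval :: "bexp \<Rightarrow> state \<Rightarrow> bool" where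
  "bval (ILess x y) s \<longleftrightarrow> ival x s < ival y s"
| "bval (RLess x y) s \<longleftrightarrow> rval x s < rval y s"
| "bval (Neg b) s \<longleftrightarrow> \<not> bval b s"
| "bval (Conj b c) s \<longleftrightarrow> bval b s \<and> bval c s"

text \<open>\<open>exec \<omega> c s s' t\<close>: on the tape \<open>\<omega>\<close> of random values, \<open>c\<close> started in \<open>s\<close> halts in \<open>s'\<close> after
  \<open>t\<close> steps. The \<open>k\<close>-th draw reads a cell with index \<open>k\<close>, so that no cell is read twice. Each
  elementary command and each test counts as one step; this agrees with counting operations up to a
  factor that depends only on the program.\<close>

type_synonym tape = "noise \<times> nat \<Rightarrow> real"

inductive exec :: "tape \<Rightarrow> com \<Rightarrow> state \<Rightarrow> state \<Rightarrow> nat \<Rightarrow> bool" for \<omega> :: tape where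
  Skip: "exec \<omega> Skip s s 1"
| IAssign: "exec \<omega> (IAssign a i j x) s
    (s\<lparr>imem := store (imem s) a (ival i s) (ival j s) (ival x s)\<rparr>) 1"
| RAssign: "exec \<omega> (RAssign a i j x) s
    (s\<lparr>rmem := store (rmem s) a (ival i s) (ival j s) (rval x s)\<rparr>) 1"
| Draw: "exec \<omega> (Draw d a i j) s
    (s\<lparr>rmem := store (rmem s) a (ival i s) (ival j s) (\<omega> (d, draws s)),
       draws := Suc (draws s)\<rparr>) 1"
| Seq: "exec \<omega> c1 s s1 t1 \<Longrightarrow> exec \<omega> c2 s1 s2 t2 \<Longrightarrow> exec \<omega> (Seq c1 c2) s s2 (t1 + t2)"
| CondTrue: "bval b s \<Longrightarrow> exec \<omega> c1 s s' t \<Longrightarrow> exec \<omega> (Cond b c1 c2) s s' (Suc t)"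
| CondFalse: "\<not> bval b s \<Longrightarrow> exec \<omega> c2 s s' t \<Longrightarrow> exec \<omega> (Cond b c1 c2) s s' (Suc t)"
| WhileFalse: "\<not> bval b s \<Longrightarrow> exec \<omega> (While b c) s s 1"
| WhileTrue: "bval b s \<Longrightarrow> exec \<omega> c s s1 t1 \<Longrightarrow> exec \<omega> (While b c) s1 s2 t2
    \<Longrightarrow> exec \<omega> (While b c) s s2 (Suc (t1 + t2))"

inductive_cases SkipE: "exec \<omega> Skip s s' t"
  and IAssignE: "exec \<omega> (IAssign a i j x) s s' t"
  and RAssignE: "exec \<omega> (RAssign a i j r) s s' t"
  and DrawE: "exec \<omega> (Draw d a i j) s s' t"
  and SeqE: "exec \<omega> (Seq c1 c2) s s' t"
  and CondE: "exec \<omega> (Cond b c1 c2) s s' t"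
  and WhileE: "exec \<omega> (While b c) s s' t"

lemma exec_deterministic:
  "exec \<omega> c s s1 t1 \<Longrightarrow> exec \<omega> c s s2 t2 \<Longrightarrow> s2 = s1 \<and> t2 = t1"
proof (induction arbitrary: s2 t2 rule: exec.induct)
  case (Seq c1 s s1 t1 c2 s2' t2')
  from Seq.prems show ?case by (rule SeqE) (use Seq.IH in blast)
next
  case (CondTrue b s c1 s' t c2)
  from CondTrue.prems show ?case by (rule CondE) (use CondTrue in blast)+
next
  case (CondFalse b s c2 s' t c1)
  from CondFalse.prems show ?case by (rule CondE) (use CondFalse in blast)+
next
  case (WhileFalse b s c)
  from WhileFalse.prems show ?case by (rule WhileE) (use WhileFalse.hyps in simp_all)
next
  case (WhileTrue b s c s1 t1 s2' t2')
  from WhileTrue.prems show ?case by (rule WhileE) (use WhileTrue in blast)+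
qed (auto elim: SkipE IAssignE RAssignE DrawE)

definition final_state :: "tape \<Rightarrow> com \<Rightarrow> state \<Rightarrow> state" where
  "final_state \<omega> c s = (THE s'. \<exists>t. exec \<omega> c s s' t)"

lemma final_state_eq: "exec \<omega> c s s' t \<Longrightarrow> final_state \<omega> c s = s'"
  unfolding final_state_def by (rule the_equality) (auto dest: exec_deterministic)

primrec noise_distribution :: "noise \<Rightarrow> real measure" where
  "noise_distribution Laplace = density lborel (\<lambda>x. ennreal (exp (- \<bar>x\<bar>) / 2))"
| "noise_distribution Gauss = density lborel (\<lambda>x. ennreal (std_normal_density x))"

definition noise_tape :: "tape measure" where
  "noise_tape = Pi\<^sub>M UNIV (\<lambda>(d, k). noise_distribution d)"

section \<open>Algorithms on networks\<close>

text \<open>Encoding of the input: \<open>n\<close>, the adjacency matrix, the matrices of edge lengths and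
  attributes, and the two privacy parameters. All other cells are zero. In particular nothing
  depends on the values of \<open>w\<close> outside the edge set.\<close>

definition input :: "network \<Rightarrow> (nat set \<Rightarrow> real) \<Rightarrow> real \<Rightarrow> real \<Rightarrow> state" where
  "input G w \<epsilon> \<delta> =
    \<lparr>imem = (\<lambda>a i j. if a = 0 \<and> i = 0 \<and> j = 0 then nverts G
                     else if a = 1 \<and> {i, j} \<in> edges G then 1
                     else 0),
     rmem = (\<lambda>a i j. if a = 0 \<and> {i, j} \<in> edges G then edge_len G {i, j}
                     else if a = 1 \<and> {i, j} \<in> edges G then w {i, j}
                     else if a = 2 \<and> i = 0 \<and> j = 0 then \<epsilon>
                     else if a = 2 \<and> i = 0 \<and> j = 1 then \<delta>
                     else 0),
     draws = 0\<rparr>"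

text \<open>The released output is the contents of real array 3 at the vertex pairs.\<close>

definition released :: "network \<Rightarrow> state \<Rightarrow> (nat \<times> nat \<Rightarrow> real)" where
  "released G s = restrict (\<lambda>(u, v). rmem s 3 u v) (vertex_pairs G)"

definition output_space :: "network \<Rightarrow> (nat \<times> nat \<Rightarrow> real) measure" where
  "output_space G = Pi\<^sub>M (vertex_pairs G) (\<lambda>_. borel)"

definition run :: "com \<Rightarrow> network \<Rightarrow> (nat set \<Rightarrow> real) \<Rightarrow> real \<Rightarrow> real \<Rightarrow> tape \<Rightarrow> (nat \<times> nat \<Rightarrow> real)" where
  "run c G w \<epsilon> \<delta> \<omega> = released G (final_state \<omega> c (input G w \<epsilon> \<delta>))"

definition mechanism :: "com \<Rightarrow> network \<Rightarrow> real \<Rightarrow> real \<Rightarrow> (nat set \<Rightarrow> real) \<Rightarrow> (nat \<times> nat \<Rightarrow> real) measure" where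
  "mechanism c G \<epsilon> \<delta> w = distr noise_tape (output_space G) (run c G w \<epsilon> \<delta>)"

text \<open>The step bound holds for every input in \<open>I\<close> and every sequence of random values. Measurability
  makes \<open>mechanism\<close> the actual output distribution.\<close>

definition efficient_algorithm :: "com \<Rightarrow> (network \<times> (nat set \<Rightarrow> real) \<times> real \<times> real) set \<Rightarrow> bool" where
  "efficient_algorithm c I \<longleftrightarrow>
     (\<exists>p :: nat poly. \<forall>(G, w, \<epsilon>, \<delta>)\<in>I. \<forall>\<omega>. \<exists>s t.
        exec \<omega> c (input G w \<epsilon> \<delta>) s t \<and> t \<le> poly p (nverts G))
     \<and> (\<forall>(G, w, \<epsilon>, \<delta>)\<in>I. run c G w \<epsilon> \<delta> \<in> measurable noise_tape (output_space G))"

definition differentially_private ::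
    "real \<Rightarrow> real \<Rightarrow> 'a set \<Rightarrow> ('a \<Rightarrow> 'a \<Rightarrow> bool) \<Rightarrow> ('a \<Rightarrow> 'b measure) \<Rightarrow> bool" where
  "differentially_private \<epsilon> \<delta> X nb A \<longleftrightarrow>
     (\<forall>x\<in>X. \<forall>y\<in>X. nb x y \<longrightarrow>
        (\<forall>C\<in>sets (A x). measure (A x) C \<le> exp \<epsilon> * measure (A y) C + \<delta>))"

definition accurate ::
    "real \<Rightarrow> network \<Rightarrow> (nat set \<Rightarrow> real) \<Rightarrow> (nat \<times> nat \<Rightarrow> real) measure \<Rightarrow> bool" where
  "accurate b G w M \<longleftrightarrow>
     measure M {f \<in> space M. \<forall>(u, v)\<in>vertex_pairs G. \<bar>f (u, v) - bottleneck G w u v\<bar> \<le> b}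
       \<ge> 1 - 1 / real (nverts G)"

end

theory Submission
  imports Defs
begin

text \<open>The bottleneck of a path is 1-Lipschitz in the supremum norm of the attributes. So it suffices
  to perturb every attribute by independent noise and to release the bottlenecks of the public
  shortest paths under the perturbed attributes: privacy is that of the vector of perturbed
  attributes, and the error is at most the largest noise. Neighbouring attributes are at distance at
  most 1 in \<open>L\<^sup>1\<close>, hence also in \<open>L\<^sup>2\<close>, so Laplace noise of scale \<open>1 / \<epsilon>\<close> and normal noise of standard
  deviation \<open>\<surd>(1 + 2 ln (1 / \<delta>)) / \<epsilon>\<close> are private. Among at most \<open>n\<^sup>2\<close> standard noise values, all are
  \<open>O(ln n)\<close> respectively \<open>O(\<surd>(ln n))\<close> with probability \<open>1 - 1 / n\<close>. The shortest paths are found by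
  Bellman--Ford relaxation from every vertex, carrying the bottleneck along.\<close>

section \<open>Executions\<close>

text \<open>Noise is added to the inputs, not to the answers: up to n^2 answers are computed from
  one noisy vector, so their number does not enter the privacy budget. Noisy attributes may be
  negative; this is harmless, because the paths depend on the public lengths alone. The program is
  analysed for each fixed tape, where it is deterministic; probability enters only through the
  resulting formula for its output. The summand 1 in the squared normal scale absorbs the term
  \<epsilon> / 2 of the privacy loss, using \<epsilon> < 1. It keeps the scale at least 1 /
  \<epsilon> even when \<delta> approaches 1, where the error bound of the second part tends to 0.
  This is why the constant there is chosen after a bound \<delta>0 < 1 on \<delta>.\<close>

definition wp :: "tape \<Rightarrow> com \<Rightarrow> (state \<Rightarrow> nat \<Rightarrow> bool) \<Rightarrow> state \<Rightarrow> bool" where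
  "wp \<omega> c Q s \<longleftrightarrow> (\<exists>s' t. exec \<omega> c s s' t \<and> Q s' t)"

lemma wp_mono: "wp \<omega> c Q s \<Longrightarrow> (\<And>s' t. Q s' t \<Longrightarrow> Q' s' t) \<Longrightarrow> wp \<omega> c Q' s"
  unfolding wp_def by blast

lemma wp_Skip [simp]: "wp \<omega> Skip Q s \<longleftrightarrow> Q s 1"
  unfolding wp_def by (fastforce intro: exec.intros[unfolded One_nat_def] elim: SkipE)

lemma wp_IAssign [simp]: "wp \<omega> (IAssign a i j x) Q s \<longleftrightarrow>
    Q (s\<lparr>imem := store (imem s) a (ival i s) (ival j s) (ival x s)\<rparr>) 1"
  unfolding wp_def by (fastforce intro: exec.intros[unfolded One_nat_def] elim: IAssignE)

lemma wp_RAssign [simp]: "wp \<omega> (RAssign a i j x) Q s \<longleftrightarrow>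
    Q (s\<lparr>rmem := store (rmem s) a (ival i s) (ival j s) (rval x s)\<rparr>) 1"
  unfolding wp_def by (fastforce intro: exec.intros[unfolded One_nat_def] elim: RAssignE)

lemma wp_Draw [simp]: "wp \<omega> (Draw d a i j) Q s \<longleftrightarrow>
    Q (s\<lparr>rmem := store (rmem s) a (ival i s) (ival j s) (\<omega> (d, draws s)),
       draws := Suc (draws s)\<rparr>) 1"
  unfolding wp_def by (fastforce intro: exec.intros[unfolded One_nat_def] elim: DrawE)

lemma wp_Seq [simp]: "wp \<omega> (Seq c1 c2) Q s \<longleftrightarrow>
    wp \<omega> c1 (\<lambda>s1 t1. wp \<omega> c2 (\<lambda>s2 t2. Q s2 (t1 + t2)) s1) s"
  unfolding wp_def by (blast intro: exec.intros elim: SeqE)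

lemma wp_Cond [simp]: "wp \<omega> (Cond b c1 c2) Q s \<longleftrightarrow>
    (if bval b s then wp \<omega> c1 (\<lambda>s' t. Q s' (Suc t)) s else wp \<omega> c2 (\<lambda>s' t. Q s' (Suc t)) s)"
  unfolding wp_def by (auto intro: exec.intros elim!: CondE)

lemma wp_While_False: "\<not> bval b s \<Longrightarrow> Q s 1 \<Longrightarrow> wp \<omega> (While b c) Q s"
  unfolding wp_def by (blast intro: exec.intros)

lemma wp_While_True:
  "bval b s \<Longrightarrow> wp \<omega> c (\<lambda>s1 t1. wp \<omega> (While b c) (\<lambda>s2 t2. Q s2 (Suc (t1 + t2))) s1) s
    \<Longrightarrow> wp \<omega> (While b c) Q s"
  unfolding wp_def by (blast intro: exec.intros)

lemma store_apply [simp]: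
  "store m a i j x b k l = (if b = a \<and> k = i \<and> l = j then x else m b k l)"
  by (simp add: store_def)

section \<open>Loops over the vertices, with their step counts\<close>

definition counter :: "nat \<Rightarrow> iexp" where
  "counter k = IRead 2 (IConst k) (IConst 0)"

lemma ival_counter [simp]: "ival (counter k) s = imem s 2 k 0"
  by (simp add: counter_def)

text \<open>Every nesting level \<open>k\<close> has its own counter cell in natural array 2, so
  nested loops do not disturb each other.\<close>

definition for_verts :: "nat \<Rightarrow> com \<Rightarrow> com" where
  "for_verts k c = Seq (IAssign 2 (IConst k) (IConst 0) (IConst 0))
    (While (ILess (counter k) (IRead 0 (IConst 0) (IConst 0)))
      (Seq c (IAssign 2 (IConst k) (IConst 0) (IAdd (counter k) (IConst 1)))))"

text \<open>\<open>I i\<close> describes the state before iteration \<open>i\<close>. Besides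
  running \<open>c\<close>, the loop writes only its counter cell, and \<open>frame\<close> carries
  \<open>I\<close> across these writes. An iteration costs the body, one test and one increment; the
  initial assignment and the last, failing test account for the final 2.\<close>

lemma wp_for_verts:
  assumes step: "\<And>i s. i < n \<Longrightarrow> I i s \<Longrightarrow> imem s 2 k 0 = i \<Longrightarrow>
      wp \<omega> c (\<lambda>s' t. t \<le> T \<and> imem s' 2 k 0 = i \<and> I (Suc i) s') s"
    and frame: "\<And>i s m. I i s \<Longrightarrow> I i (s\<lparr>imem := store (imem s) 2 k 0 m\<rparr>)"
    and n: "\<And>i s. I i s \<Longrightarrow> imem s 0 0 0 = n"
    and init: "I 0 s"
  shows "wp \<omega> (for_verts k c) (\<lambda>s' t. t \<le> n * (T + 2) + 2 \<and> I n s') s"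
proof -
  let ?b = "ILess (counter k) (IRead 0 (IConst 0) (IConst 0))"
  let ?c = "Seq c (IAssign 2 (IConst k) (IConst 0) (IAdd (counter k) (IConst 1)))"
  have "wp \<omega> (While ?b ?c) (\<lambda>s' t. t \<le> m * (T + 2) + 1 \<and> I n s') s"
    if "i + m = n" "I i s" "imem s 2 k 0 = i" for m i s
    using that
  proof (induction m arbitrary: i s)
    case 0
    then show ?case by (intro wp_While_False) (auto simp: n)
  next
    case (Suc m)
    have b: "bval ?b s" using Suc.prems n[of i s] by simp
    have "wp \<omega> c (\<lambda>s' t. t \<le> T \<and> imem s' 2 k 0 = i \<and> I (Suc i) s') s"
      using Suc.prems by (intro step) auto
    then have "wp \<omega> ?c (\<lambda>s' t. t \<le> T + 1 \<and> imem s' 2 k 0 = Suc i \<and> I (Suc i) s') s"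
      by simp (erule wp_mono, auto intro: frame)
    then have "wp \<omega> ?c (\<lambda>s1 t1. wp \<omega> (While ?b ?c)
        (\<lambda>s2 t2. Suc (t1 + t2) \<le> Suc m * (T + 2) + 1 \<and> I n s2) s1) s"
    proof (rule wp_mono)
      fix s1 t1 assume 1: "t1 \<le> T + 1 \<and> imem s1 2 k 0 = Suc i \<and> I (Suc i) s1"
      then have "wp \<omega> (While ?b ?c) (\<lambda>s' t. t \<le> m * (T + 2) + 1 \<and> I n s') s1"
        using Suc.prems by (intro Suc.IH[of "Suc i"]) auto
      then show "wp \<omega> (While ?b ?c) (\<lambda>s2 t2. Suc (t1 + t2) \<le> Suc m * (T + 2) + 1 \<and> I n s2) s1"
        by (rule wp_mono) (use 1 in auto)
    qed
    then show ?case by (rule wp_While_True[OF b])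
  qed
  from this[of 0 n "s\<lparr>imem := store (imem s) 2 k 0 0\<rparr>"]
  have "wp \<omega> (While ?b ?c) (\<lambda>s' t. t \<le> n * (T + 2) + 1 \<and> I n s')
     (s\<lparr>imem := store (imem s) 2 k 0 0\<rparr>)"
    using frame[OF init] by simp
  then show ?thesis
    unfolding for_verts_def by simp
qed

section \<open>Paths\<close>

lemma path_edges_trivial [simp]: "path_edges [] = []" "path_edges [u] = []"
  by (simp_all add: path_edges_def)

lemma path_edges_Cons: "p \<noteq> [] \<Longrightarrow> path_edges (u # p) = {u, hd p} # path_edges p"
  by (cases p) (auto simp: path_edges_def)

lemma path_edges_snoc: "p \<noteq> [] \<Longrightarrow> path_edges (p @ [v]) = path_edges p @ [{last p, v}]"
proof (induction p)
  case (Cons a p)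
  then show ?case by (cases "p = []") (auto simp: path_edges_Cons)
qed simp

lemma path_length_snoc:
  "p \<noteq> [] \<Longrightarrow> path_length G (p @ [v]) = path_length G p + edge_len G {last p, v}"
  by (simp add: path_length_def path_edges_snoc)

lemma path_edges_prefix: "set (path_edges q) \<subseteq> set (path_edges (q @ r))"
proof (induction r rule: rev_induct)
  case (snoc x r)
  then show ?case
    by (cases "q @ r = []") (auto simp: path_edges_snoc simp flip: append_assoc)
qed simp

lemma is_path_snoc:
  assumes "q \<noteq> []"
  shows "is_path G u v (q @ [v]) \<longleftrightarrow>
    is_path G u (last q) q \<and> v \<notin> set q \<and> v < nverts G \<and> {last q, v} \<in> edges G"
  using assms by (auto simp: is_path_def path_edges_snoc)

lemma is_path_prefix:
  assumes "is_path G u v (q @ r)" "q \<noteq> []"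
  shows "is_path G u (last q) q"
  using assms path_edges_prefix[of q r] unfolding is_path_def by auto

lemma is_path_last: "is_path G u v p \<Longrightarrow> last p = v" "is_path G u v p \<Longrightarrow> p \<noteq> []"
  by (auto simp: is_path_def)

lemma is_path_self: "is_path G u u p \<Longrightarrow> p = [u]"
  by (cases p) (auto simp: is_path_def dest: last_in_set split: if_splits)

lemma path_edges_eq_Nil:
  assumes "is_path G u v p"
  shows "path_edges p = [] \<longleftrightarrow> u = v"
proof
  assume "path_edges p = []"
  then have "tl p = []" using path_edges_Cons[of "tl p" "hd p"] assms by (cases p) (auto simp: is_path_def)
  then show "u = v" using assms by (cases p) (auto simp: is_path_def)
next
  assume "u = v"
  then show "path_edges p = []" using assms is_path_self[of G u p] by simp
qed

lemma path_length_prefix: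
  assumes "wf_network G" "is_path G u v (q @ r)" "q \<noteq> []"
  shows "path_length G q \<le> path_length G (q @ r)"
  using assms(2)
proof (induction r arbitrary: v rule: rev_induct)
  case (snoc x r)
  have "x = v" using snoc.prems by (simp add: is_path_def)
  with snoc.prems assms(3) have p: "is_path G u (last (q @ r)) (q @ r)"
    and e: "{last (q @ r), v} \<in> edges G"
    using is_path_snoc[of "q @ r" G u v] by simp_all
  have "0 \<le> edge_len G {last (q @ r), v}" using assms(1) e by (simp add: wf_network_def)
  with snoc.IH[OF p] show ?case
    using path_length_snoc[of "q @ r" G x] assms(3) \<open>x = v\<close> by simp
qed simp

lemma length_path_le:
  assumes "is_path G u v p"
  shows "length p \<le> nverts G"
  using assms card_mono[of "{..<nverts G}" "set p"]
  by (simp add: is_path_def distinct_card)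

section \<open>Relaxation\<close>

text \<open>\<open>R\<close>, \<open>D\<close> and \<open>B\<close> are the reachability flags, the distance estimates and the bottleneck
  estimates. The prefix condition guarantees that a strict improvement never closes a cycle, so that
  the tracked path stays simple even though edges of length zero are allowed.\<close>

definition sound where
  "sound G W R D B \<longleftrightarrow> (\<forall>u<nverts G. \<forall>v<nverts G. R u v \<noteq> (0::nat) \<longrightarrow>
     (\<exists>p. is_path G u v p \<and> D u v = path_length G p
        \<and> (u \<noteq> v \<longrightarrow> B u v = Min (W ` set (path_edges p)))
        \<and> (\<forall>q r. p = q @ r \<longrightarrow> q \<noteq> [] \<longrightarrow> R u (last q) \<noteq> 0 \<and> D u (last q) \<le> path_length G q)))"

text \<open>\<open>t\<close> counts vertices, not edges: \<open>t = 1\<close> concerns only the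
  trivial paths, and \<open>t = nverts G\<close> all simple paths.\<close>

definition complete_upto where
  "complete_upto G t R D \<longleftrightarrow> (\<forall>u<nverts G. \<forall>v<nverts G. \<forall>q. is_path G u v q \<longrightarrow> length q \<le> t \<longrightarrow>
     R u v \<noteq> (0::nat) \<and> D u v \<le> path_length G q)"

text \<open>\<open>S\<close> records the triples of source, target and penultimate vertex already
  tried in the current round. This is the partial progress from one instance of
  \<open>complete_upto\<close> to the next.\<close>

definition relaxed where
  "relaxed G t S R D \<longleftrightarrow> (\<forall>(u, v, x)\<in>S. \<forall>q. is_path G u x q \<longrightarrow> is_path G u v (q @ [v]) \<longrightarrow>
     length q \<le> t \<longrightarrow> R u v \<noteq> (0::nat) \<and> D u v \<le> path_length G (q @ [v]))"

text \<open>Cut off the last vertex of the path: what remains has at most \<open>t\<close> vertices,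
  and its end is the third component of a triple that the round has treated.\<close>

lemma complete_upto_Suc:
  assumes "complete_upto G t R D" "relaxed G t ({..<nverts G} \<times> {..<nverts G} \<times> {..<nverts G}) R D"
    and "1 \<le> t"
  shows "complete_upto G (Suc t) R D"
  unfolding complete_upto_def
proof (intro allI impI)
  fix u v q assume uv: "u < nverts G" "v < nverts G" and q: "is_path G u v q" "length q \<le> Suc t"
  show "R u v \<noteq> 0 \<and> D u v \<le> path_length G q"
  proof (cases "butlast q = []")
    \<comment> \<open>A path with empty \<open>butlast\<close> is a single vertex; here
      \<open>1 \<le> t\<close> enters.\<close>
    case True
    then have "length q \<le> t" using q assms(3) by (cases q) (auto split: if_splits)
    then show ?thesis using assms(1) uv q by (auto simp: complete_upto_def)
  next
    case False
    have "q = butlast q @ [v]" using q(1) by (auto simp: is_path_def)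
    then obtain q' where eq: "q = q' @ [v]" and "q' \<noteq> []" using False by metis
    then have q': "is_path G u (last q') q'" using is_path_prefix[of G u v q' "[v]"] q(1) by simp
    then have "last q' < nverts G" using last_in_set[OF \<open>q' \<noteq> []\<close>] unfolding is_path_def by blast
    then have "(u, v, last q') \<in> {..<nverts G} \<times> {..<nverts G} \<times> {..<nverts G}" using uv by simp
    with assms(2) q q' show ?thesis
      unfolding relaxed_def eq by fastforce
  qed
qed

text \<open>Flags are never cleared and estimates never rise, which is \<open>mono\<close> below.
  Hence an update in the middle of a round damages neither the prefix conditions of the other stored
  paths nor the bounds for triples treated earlier.\<close>

lemma relax:
  assumes G: "wf_network G" and S: "sound G W R D B"
    and uvx: "u < nverts G" "v < nverts G" "x < nverts G"
    and e: "{x, v} \<in> edges G" and Rx: "R u x \<noteq> 0"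
    and g: "R u v = 0 \<or> D u x + edge_len G {x, v} < D u v"
    and D': "D' = (\<lambda>a b. if a = u \<and> b = v then D u x + edge_len G {x, v} else D a b)"
    and R': "R' = (\<lambda>a b. if a = u \<and> b = v then 1 else R a b)"
    and B': "B' = (\<lambda>a b. if a = u \<and> b = v then (if x = u then W {x, v} else min (B u x) (W {x, v})) else B a b)"
  shows "sound G W R' D' B'"
    and "complete_upto G t R D \<Longrightarrow> complete_upto G t R' D'"
    and "complete_upto G t R D \<Longrightarrow> relaxed G t T R D \<Longrightarrow> relaxed G t (insert (u, v, x) T) R' D'"
proof -
  have mono: "R' a b \<noteq> 0 \<and> D' a b \<le> D a b" if "R a b \<noteq> 0" for a b
    using that g by (auto simp: R' D')
  have "0 \<le> edge_len G {x, v}" using G e by (simp add: wf_network_def)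
  show "sound G W R' D' B'"
    unfolding sound_def
  proof (intro allI impI)
    fix a b assume ab: "a < nverts G" "b < nverts G" and R'ab: "R' a b \<noteq> 0"
    show "\<exists>p. is_path G a b p \<and> D' a b = path_length G p
        \<and> (a \<noteq> b \<longrightarrow> B' a b = Min (W ` set (path_edges p)))
        \<and> (\<forall>q r. p = q @ r \<longrightarrow> q \<noteq> [] \<longrightarrow> R' a (last q) \<noteq> 0 \<and> D' a (last q) \<le> path_length G q)"
    proof (cases "a = u \<and> b = v")
      case False
      then have "R a b \<noteq> 0" using R'ab by (auto simp: R')
      with S ab obtain p where p: "is_path G a b p" "D a b = path_length G p"
        "a \<noteq> b \<longrightarrow> B a b = Min (W ` set (path_edges p))"
        "\<And>q r. p = q @ r \<Longrightarrow> q \<noteq> [] \<Longrightarrow> R a (last q) \<noteq> 0 \<and> D a (last q) \<le> path_length G q"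
        unfolding sound_def by metis
      have "R' a (last q) \<noteq> 0 \<and> D' a (last q) \<le> path_length G q" if "p = q @ r" "q \<noteq> []" for q r
        using p(4)[OF that] mono[of a "last q"] by linarith
      moreover have "D' a b = D a b" "B' a b = B a b" using False by (auto simp: D' B')
      ultimately show ?thesis using p(1-3) by (intro exI[of _ p] conjI impI allI) simp_all
    next
      case True
      from S uvx(1,3) Rx obtain p where p: "is_path G u x p" "D u x = path_length G p"
        "u \<noteq> x \<longrightarrow> B u x = Min (W ` set (path_edges p))"
        "\<And>q r. p = q @ r \<Longrightarrow> q \<noteq> [] \<Longrightarrow> R u (last q) \<noteq> 0 \<and> D u (last q) \<le> path_length G q"
        unfolding sound_def by metis
      note pl = is_path_last[OF p(1)]
      \<comment> \<open>Otherwise some prefix of \<open>p\<close> ends at \<open>v\<close>, so the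
        estimate at \<open>(u, v)\<close> is at most the length of that prefix, hence of
        \<open>p\<close>. As the new edge has nonnegative length, this contradicts the strict
        inequality in \<open>g\<close>.\<close>
      have vp: "v \<notin> set p"
      proof
        assume "v \<in> set p"
        then obtain q1 r where "p = q1 @ v # r" by (meson split_list)
        then have eq: "p = (q1 @ [v]) @ r" by simp
        from p(4)[OF eq] have "R u v \<noteq> 0" "D u v \<le> path_length G (q1 @ [v])" by simp_all
        moreover have "path_length G (q1 @ [v]) \<le> path_length G p"
          using path_length_prefix[OF G, of u x "q1 @ [v]" r] p(1) eq by simp
        ultimately show False using g p(2) \<open>0 \<le> edge_len G {x, v}\<close> by linarith
      qed
      have path: "is_path G u v (p @ [v])"
        using is_path_snoc[of p G u v] pl p(1) vp e uvx by simp
      have len: "path_length G (p @ [v]) = D' u v"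
        using path_length_snoc[of p G v] pl p(2) by (simp add: D')
      have B: "B' u v = Min (W ` set (path_edges (p @ [v])))"
      \<comment> \<open>For \<open>x = u\<close> the stored path has no edge and
        \<open>B u u\<close> carries no information, so the minimum starts with the new
        edge.\<close>
      proof (cases "x = u")
        case True
        then have "p = [u]" using p(1) is_path_self by blast
        then show ?thesis using True path_edges_snoc[of "[u]" v] by (simp add: B')
      next
        case False
        then have "path_edges p \<noteq> []" using path_edges_eq_Nil[OF p(1)] by simp
        then show ?thesis using False pl p(3) by (simp add: B' path_edges_snoc min.commute)
      qed
      have pre: "R' u (last q) \<noteq> 0 \<and> D' u (last q) \<le> path_length G q" if "p @ [v] = q @ r" "q \<noteq> []" for q r
      proof (cases r rule: rev_cases)
        case Nil
        then have "q = p @ [v]" using that(1) by simp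
        then show ?thesis using len by (simp add: R')
      next
        case (snoc r' y)
        then have "p = q @ r'" using that(1) by simp
        then show ?thesis using p(4)[of q r'] mono[of u "last q"] that(2) by linarith
      qed
      have ab: "a = u" "b = v" using True by simp_all
      show ?thesis unfolding ab
        using path len[symmetric] B pre by (intro exI[of _ "p @ [v]"] conjI impI allI) simp_all
    qed
  qed
  show "complete_upto G t R' D'" if "complete_upto G t R D"
    unfolding complete_upto_def
  proof (intro allI impI)
    fix a b q assume "a < nverts G" "b < nverts G" "is_path G a b q" "length q \<le> t"
    with that have "R a b \<noteq> 0" "D a b \<le> path_length G q" by (auto simp: complete_upto_def)
    with mono[of a b] show "R' a b \<noteq> 0 \<and> D' a b \<le> path_length G q" by linarith
  qed
  show "relaxed G t (insert (u, v, x) T) R' D'" if C: "complete_upto G t R D" and T: "relaxed G t T R D"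
    unfolding relaxed_def
  proof (clarify)
    fix a b y q assume i: "(a, b, y) \<in> insert (u, v, x) T"
      and q: "is_path G a y q" "is_path G a b (q @ [b])" "length q \<le> t"
    show "R' a b \<noteq> 0 \<and> D' a b \<le> path_length G (q @ [b])"
    proof (cases "(a, b, y) = (u, v, x)")
      case True
      then have "D u x \<le> path_length G q" using C uvx q by (auto simp: complete_upto_def)
      then show ?thesis
        using True path_length_snoc[of q G v] is_path_last[OF q(1)] by (simp add: R' D')
    next
      case False
      then have "R a b \<noteq> 0 \<and> D a b \<le> path_length G (q @ [b])"
        using T i q unfolding relaxed_def by blast
      with mono[of a b] show ?thesis by linarith
    qed
  qed
qed

text \<open>The test fails for one of three reasons. Without the edge there is no path to bound; if
  \<open>x\<close> is not flagged, no path with at most \<open>t\<close> vertices leads there;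
  otherwise the estimate at \<open>(u, v)\<close> is already no larger than the candidate.\<close>

lemma relaxed_insert_skip:
  assumes "complete_upto G t R D" "relaxed G t T R D" "u < nverts G" "x < nverts G"
    and g: "\<not> ({x, v} \<in> edges G \<and> R u x \<noteq> 0 \<and> (R u v = 0 \<or> D u x + edge_len G {x, v} < D u v))"
  shows "relaxed G t (insert (u, v, x) T) R D"
  unfolding relaxed_def
proof (clarify)
  fix a b y q assume i: "(a, b, y) \<in> insert (u, v, x) T"
    and q: "is_path G a y q" "is_path G a b (q @ [b])" "length q \<le> t"
  show "R a b \<noteq> 0 \<and> D a b \<le> path_length G (q @ [b])"
  proof (cases "(a, b, y) = (u, v, x)")
    case True
    have l: "last q = x" "q \<noteq> []" using is_path_last[OF q(1)] True by simp_all
    have "R u x \<noteq> 0" "D u x \<le> path_length G q"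
      using assms(1,3,4) q True by (auto simp: complete_upto_def)
    moreover have "{x, v} \<in> edges G" using q(2) True l by (simp add: is_path_snoc)
    ultimately show ?thesis using g True path_length_snoc[of q G v] l by auto
  next
    case False
    then show ?thesis using assms(2) i q unfolding relaxed_def by blast
  qed
qed

text \<open>A simple path has at most \<open>nverts G\<close> vertices, so completeness covers the
  shortest one. The path that \<open>sound\<close> provides is then no longer, hence also shortest,
  and uniqueness identifies the two.\<close>

lemma sound_complete_bottleneck:
  assumes G: "unique_shortest_paths G" and S: "sound G W R D B"
    and C: "complete_upto G t R D" and t: "nverts G \<le> t"
    and uv: "u < nverts G" "v < nverts G" "u \<noteq> v"
  shows "B u v = bottleneck G W u v"
proof -
  from G uv have ex: "\<exists>!p. is_shortest_path G u v p" by (simp add: unique_shortest_paths_def)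
  then obtain q where q: "is_shortest_path G u v q" by blast
  then have "is_path G u v q" by (simp add: is_shortest_path_def)
  then have "length q \<le> t" using length_path_le t by (meson order_trans)
  with C uv \<open>is_path G u v q\<close> have R: "R u v \<noteq> 0" and D: "D u v \<le> path_length G q"
    by (simp_all add: complete_upto_def)
  from S uv R obtain p where p: "is_path G u v p" "D u v = path_length G p"
    "B u v = Min (W ` set (path_edges p))"
    unfolding sound_def by metis
  have "is_shortest_path G u v p"
    using p(1) D[unfolded p(2)] q unfolding is_shortest_path_def by (meson order_trans)
  then have "shortest_path G u v = p" unfolding shortest_path_def using ex by (rule the1_equality[rotated])
  then show ?thesis using p(3) by (simp add: bottleneck_def)
qed

lemma shortest_path_edges:
  assumes G: "unique_shortest_paths G" and uv: "(u, v) \<in> vertex_pairs G"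
  shows "set (path_edges (shortest_path G u v)) \<subseteq> edges G"
    and "path_edges (shortest_path G u v) \<noteq> []"
proof -
  have "\<exists>!p. is_shortest_path G u v p"
    using G uv by (simp add: unique_shortest_paths_def vertex_pairs_def)
  from theI'[OF this] have "is_path G u v (shortest_path G u v)"
    by (simp add: shortest_path_def is_shortest_path_def)
  then show "set (path_edges (shortest_path G u v)) \<subseteq> edges G"
    "path_edges (shortest_path G u v) \<noteq> []"
    using uv path_edges_eq_Nil[of G u v] by (auto simp: is_path_def vertex_pairs_def)
qed

section \<open>The algorithm\<close>

text \<open>Real array 5 receives the noisy attributes. The iteration \<open>(i, j)\<close> overwrites the cells
  \<open>(i, j)\<close> and \<open>(j, i)\<close>, so the draw that survives for an edge is the one made at
  (larger end, smaller end).\<close>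

definition add_noise :: "noise \<Rightarrow> rexp \<Rightarrow> com" where
  "add_noise d sc =
    for_verts 0 (Seq (IAssign 3 (counter 0) (counter 0) (IConst 1))
     (for_verts 1 (Seq (Draw d 5 (counter 0) (counter 1))
      (Seq (RAssign 5 (counter 0) (counter 1)
        (RAdd (RRead 1 (counter 0) (counter 1)) (RMul sc (RRead 5 (counter 0) (counter 1)))))
       (RAssign 5 (counter 1) (counter 0) (RRead 5 (counter 0) (counter 1)))))))"

text \<open>Natural array 3, real array 6 and real array 3 hold \<open>R\<close>, \<open>D\<close>
  and \<open>B\<close>; the last is also the released array. Negated conjunctions stand for the
  disjunction in the improvement test and for the equality of \<open>x\<close> and
  \<open>u\<close>.\<close>

definition relax_edge :: "iexp \<Rightarrow> iexp \<Rightarrow> iexp \<Rightarrow> com" where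
  "relax_edge u v x =
    Cond (Conj (Conj (ILess (IConst 0) (IRead 1 x v)) (ILess (IConst 0) (IRead 3 u x)))
        (Neg (Conj (ILess (IConst 0) (IRead 3 u v))
          (Neg (RLess (RAdd (RRead 6 u x) (RRead 0 x v)) (RRead 6 u v))))))
      (Seq (IAssign 3 u v (IConst 1))
       (Seq (RAssign 6 u v (RAdd (RRead 6 u x) (RRead 0 x v)))
         (Cond (Conj (Neg (ILess x u)) (Neg (ILess u x)))
           (RAssign 3 u v (RRead 5 x v))
           (Cond (RLess (RRead 3 u x) (RRead 5 x v))
             (RAssign 3 u v (RRead 3 u x))
             (RAssign 3 u v (RRead 5 x v))))))
      Skip"

text \<open>\<open>counter 0\<close> names no vertex; it only counts n rounds over all
  triples.\<close>

definition find_bottlenecks :: com where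
  "find_bottlenecks =
    for_verts 0 (for_verts 1 (for_verts 2 (for_verts 3
      (relax_edge (counter 1) (counter 2) (counter 3)))))"

definition private_bottlenecks :: "noise \<Rightarrow> rexp \<Rightarrow> com" where
  "private_bottlenecks d sc = Seq (add_noise d sc) find_bottlenecks"

text \<open>The part of \<open>input\<close> that no command of the algorithm overwrites, which
  makes it usable as an invariant.\<close>

definition input_state :: "network \<Rightarrow> (nat set \<Rightarrow> real) \<Rightarrow> real \<Rightarrow> real \<Rightarrow> state \<Rightarrow> bool" where
  "input_state G w \<epsilon> \<delta> s \<longleftrightarrow> imem s 0 0 0 = nverts G
    \<and> (\<forall>i j. imem s 1 i j \<noteq> 0 \<longleftrightarrow> {i, j} \<in> edges G)
    \<and> (\<forall>i j. {i, j} \<in> edges G \<longrightarrow> rmem s 0 i j = edge_len G {i, j} \<and> rmem s 1 i j = w {i, j})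
    \<and> rmem s 2 0 0 = \<epsilon> \<and> rmem s 2 0 1 = \<delta>"

definition computes_scale :: "rexp \<Rightarrow> real \<Rightarrow> real \<Rightarrow> real \<Rightarrow> bool" where
  "computes_scale sc \<epsilon> \<delta> \<sigma> \<longleftrightarrow> (\<forall>s. rmem s 2 0 0 = \<epsilon> \<and> rmem s 2 0 1 = \<delta> \<longrightarrow> rval sc s = \<sigma>)"

text \<open>Iteration \<open>(i, j)\<close> makes draw number \<open>i * n + j\<close>, and for the
  surviving draw of an edge the row \<open>i\<close> is its larger end.\<close>

definition draw_index :: "nat \<Rightarrow> nat set \<Rightarrow> nat" where
  "draw_index n e = Max e * n + Min e"

definition noisy :: "nat \<Rightarrow> noise \<Rightarrow> real \<Rightarrow> (nat set \<Rightarrow> real) \<Rightarrow> tape \<Rightarrow> nat set \<Rightarrow> real" where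
  "noisy n d \<sigma> w \<omega> e = w e + \<sigma> * \<omega> (d, draw_index n e)"

section \<open>Correctness and running time of the program\<close>

lemma add_noise_correct:
  assumes G: "wf_network G"
    and sc: "computes_scale sc \<epsilon> \<delta> \<sigma>"
  defines "n \<equiv> nverts G"
  shows "wp \<omega> (add_noise d sc) (\<lambda>s t. t \<le> n * (n * 5 + 5) + 2 \<and> input_state G w \<epsilon> \<delta> s
      \<and> (\<forall>a b. {a, b} \<in> edges G \<longrightarrow> rmem s 5 a b = noisy n d \<sigma> w \<omega> {a, b})
      \<and> (\<forall>a<n. imem s 3 a a = 1) \<and> (\<forall>a b. a \<noteq> b \<longrightarrow> imem s 3 a b = 0)
      \<and> (\<forall>a b. rmem s 6 a b = 0)) (input G w \<epsilon> \<delta>)"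
proof -
  \<comment> \<open>\<open>J i j\<close> holds before iteration \<open>(i, j)\<close>. For
    \<open>b < a\<close>, iteration \<open>(a, b)\<close> is the last one to write either cell of
    the edge, so only from then on are the two values final. The diagonal flag of a row is set
    before its inner loop, hence the separate \<open>F\<close>.\<close>
  define J where "J i j (s :: state) \<longleftrightarrow> input_state G w \<epsilon> \<delta> s \<and> draws s = i * n + j
      \<and> (\<forall>a b. {a, b} \<in> edges G \<longrightarrow> b < a \<longrightarrow> a < i \<or> a = i \<and> b < j \<longrightarrow>
           rmem s 5 a b = noisy n d \<sigma> w \<omega> {a, b} \<and> rmem s 5 b a = noisy n d \<sigma> w \<omega> {a, b})
      \<and> (\<forall>a b. a \<noteq> b \<longrightarrow> imem s 3 a b = 0)
      \<and> (\<forall>a b. rmem s 6 a b = 0)" for i j s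
  define F where "F i (s :: state) \<longleftrightarrow> (\<forall>a<i. imem s 3 a a = (1::nat))" for i s
  let ?body = "Seq (Draw d 5 (counter 0) (counter 1))
      (Seq (RAssign 5 (counter 0) (counter 1)
        (RAdd (RRead 1 (counter 0) (counter 1)) (RMul sc (RRead 5 (counter 0) (counter 1)))))
       (RAssign 5 (counter 1) (counter 0) (RRead 5 (counter 0) (counter 1))))"
  have body: "wp \<omega> ?body (\<lambda>s' t. t \<le> 3 \<and> imem s' 2 1 0 = j
      \<and> (J i (Suc j) s' \<and> F (Suc i) s' \<and> imem s' 2 0 0 = i)) s"
    if J: "J i j s" "F (Suc i) s" "imem s 2 0 0 = i" "imem s 2 1 0 = j" "i < n" "j < n" for i j s
  proof -
    have [simp]: "rval sc (s\<lparr>rmem := store (rmem s) 5 i j z, draws := m\<rparr>) = \<sigma>" for z m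
      using sc J(1) by (simp add: computes_scale_def J_def input_state_def)
    show ?thesis using that
      by (auto simp: J_def F_def input_state_def noisy_def draw_index_def fun_eq_iff less_Suc_eq)
  qed
  have inner: "wp \<omega> (for_verts 1 ?body) (\<lambda>s' t. t \<le> n * (3 + 2) + 2
      \<and> (J i n s' \<and> F (Suc i) s' \<and> imem s' 2 0 0 = i)) s"
    if "J i 0 s" "F (Suc i) s" "imem s 2 0 0 = i" "i < n" for i s
  proof (rule wp_for_verts[where I="\<lambda>j s'. J i j s' \<and> F (Suc i) s' \<and> imem s' 2 0 0 = i"], goal_cases)
    case (1 j s')
    then show ?case using that by (intro body) auto
  qed (use that in \<open>auto simp: J_def F_def input_state_def n_def\<close>)
  have "wp \<omega> (add_noise d sc) (\<lambda>s t. t \<le> n * ((n * 5 + 3) + 2) + 2 \<and> (J n 0 s \<and> F n s)) (input G w \<epsilon> \<delta>)"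
    unfolding add_noise_def
  proof (rule wp_for_verts[where I="\<lambda>i s. J i 0 s \<and> F i s"], goal_cases)
    case (1 i s)
    let ?s = "s\<lparr>imem := store (imem s) 3 i i 1\<rparr>"
    have "wp \<omega> (for_verts 1 ?body) (\<lambda>s' t. t \<le> n * (3 + 2) + 2
      \<and> (J i n s' \<and> F (Suc i) s' \<and> imem s' 2 0 0 = i)) ?s"
      using 1 by (intro inner) (auto simp: J_def F_def input_state_def less_Suc_eq)
    then have "wp \<omega> (for_verts 1 ?body) (\<lambda>s' t. 1 + t \<le> n * 5 + 3 \<and> imem s' 2 0 0 = i \<and> J (Suc i) 0 s' \<and> F (Suc i) s') ?s"
    proof (rule wp_mono)
      fix s' t
      assume a: "t \<le> n * (3 + 2) + 2 \<and> (J i n s' \<and> F (Suc i) s' \<and> imem s' 2 0 0 = i)"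
      \<comment> \<open>At the end of row \<open>i\<close> the condition \<open>b < n\<close> is
        satisfied by every edge, so the finished part of row \<open>i\<close> is the whole
        row.\<close>
      have "b < n" if "{a, b} \<in> edges G" for a b
        using that G unfolding wf_network_def n_def by (force simp: doubleton_eq_iff)
      then have "J (Suc i) 0 s'"
        using a by (auto simp: J_def less_Suc_eq)
      then show "1 + t \<le> n * 5 + 3 \<and> imem s' 2 0 0 = i \<and> J (Suc i) 0 s' \<and> F (Suc i) s'"
        using a by simp
    qed
    then show ?case using 1 by simp
  next
    case 4
    show ?case by (auto simp: J_def F_def input_state_def input_def)
  qed (auto simp: J_def F_def input_state_def n_def)
  then show ?thesis
  proof (rule wp_mono)
    fix s t assume a: "t \<le> n * (n * 5 + 3 + 2) + 2 \<and> (J n 0 s \<and> F n s)"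
    have "rmem s 5 a b = noisy n d \<sigma> w \<omega> {a, b}" if "{a, b} \<in> edges G" for a b
    proof -
      have ab: "a < n" "b < n" "a \<noteq> b"
        using that G unfolding wf_network_def n_def by (force simp: doubleton_eq_iff)+
      then consider "b < a" | "a < b" by linarith
      then show ?thesis using a that ab by cases (auto simp: J_def insert_commute)
    qed
    with a show "t \<le> n * (n * 5 + 5) + 2 \<and> input_state G w \<epsilon> \<delta> s
      \<and> (\<forall>a b. {a, b} \<in> edges G \<longrightarrow> rmem s 5 a b = noisy n d \<sigma> w \<omega> {a, b})
      \<and> (\<forall>a<n. imem s 3 a a = 1) \<and> (\<forall>a b. a \<noteq> b \<longrightarrow> imem s 3 a b = 0)
      \<and> (\<forall>a b. rmem s 6 a b = 0)"
      by (simp add: J_def F_def algebra_simps)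
  qed
qed

lemma find_bottlenecks_correct:
  assumes G: "wf_network G" "unique_shortest_paths G"
    and s: "input_state G w \<epsilon> \<delta> s" "\<And>a b. {a, b} \<in> edges G \<Longrightarrow> rmem s 5 a b = W {a, b}"
      "\<And>a. a < nverts G \<Longrightarrow> imem s 3 a a = 1" "\<And>a b. a \<noteq> b \<Longrightarrow> imem s 3 a b = 0"
      "\<And>a b. rmem s 6 a b = 0"
  defines "n \<equiv> nverts G"
  shows "wp \<omega> find_bottlenecks (\<lambda>s' t. t \<le> n * (n * (n * (n * 8 + 4) + 4) + 4) + 2 \<and>
     (\<forall>(u, v)\<in>vertex_pairs G. rmem s' 3 u v = bottleneck G W u v)) s"
proof -
  \<comment> \<open>\<open>S\<close> is the set of triples treated in round \<open>t\<close>. The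
    offset in \<open>Suc t\<close> reflects that one-vertex paths are covered before round
    0.\<close>
  define J where "J t S (s :: state) \<longleftrightarrow> input_state G w \<epsilon> \<delta> s \<and> (\<forall>a b. {a, b} \<in> edges G \<longrightarrow> rmem s 5 a b = W {a, b})
     \<and> sound G W (imem s 3) (rmem s 6) (rmem s 3) \<and> complete_upto G (Suc t) (imem s 3) (rmem s 6)
     \<and> relaxed G (Suc t) S (imem s 3) (rmem s 6)" for t S s
  have frame: "J t S (s\<lparr>imem := store (imem s) 2 k l m\<rparr>)" if "J t S s" for t S s k l m
    using that by (auto simp: J_def input_state_def store_def)
  have nv: "imem s 0 0 0 = n" if "J t S s" for t S s
    using that by (simp add: J_def input_state_def n_def)
  let ?body = "relax_edge (counter 1) (counter 2) (counter 3)"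
  have body: "wp \<omega> ?body (\<lambda>s' m. m \<le> 6 \<and> (\<forall>k. imem s' 2 k 0 = imem s 2 k 0) \<and> J t (insert (u, v, x) S) s') s"
    if J: "J t S s" and i: "imem s 2 1 0 = u" "imem s 2 2 0 = v" "imem s 2 3 0 = x"
      and uvx: "u < n" "v < n" "x < n" for t S s u v x
  proof -
    let ?R = "imem s 3" and ?D = "rmem s 6" and ?B = "rmem s 3"
    let ?g = "{x, v} \<in> edges G \<and> ?R u x \<noteq> 0 \<and> (?R u v = 0 \<or> ?D u x + edge_len G {x, v} < ?D u v)"
    show ?thesis
    proof (cases ?g)
      case False
      then have "J t (insert (u, v, x) S) s"
        using J uvx relaxed_insert_skip[of G "Suc t" ?R ?D S u x v] by (simp add: J_def n_def)
      then show ?thesis using False J i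
        by (auto simp: relax_edge_def J_def input_state_def)
    next
      case True
      define s' where "s' = s\<lparr>imem := store (imem s) 3 u v 1,
        rmem := store (store (rmem s) 6 u v (?D u x + edge_len G {x, v})) 3 u v
           (if x = u then W {x, v} else min (?B u x) (W {x, v}))\<rparr>"
      have g: "{x, v} \<in> edges G" "0 < imem s 1 x v" "0 < ?R u x"
        "rmem s 0 x v = edge_len G {x, v}" "rmem s 5 x v = W {x, v}"
        "\<not> (0 < ?R u v \<and> \<not> ?D u x + edge_len G {x, v} < ?D u v)"
        using True J by (auto simp: J_def input_state_def)
      \<comment> \<open>The exact cost of an update: testing for the smaller of two bottlenecks
        costs one step more than starting from the new edge. The larger value is the bound
        6.\<close>
      have W: "wp \<omega> ?body Q s \<longleftrightarrow>
          Q s' (if x = u then Suc (Suc (Suc (Suc (Suc 0)))) else Suc (Suc (Suc (Suc (Suc (Suc 0))))))" for Q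
        unfolding s'_def using g i
        by (cases x u rule: linorder_cases; cases "?B u x < W {x, v}") (simp_all add: relax_edge_def)
      have "sound G W (imem s' 3) (rmem s' 6) (rmem s' 3)"
        "complete_upto G (Suc t) (imem s' 3) (rmem s' 6)"
        "relaxed G (Suc t) (insert (u, v, x) S) (imem s' 3) (rmem s' 6)"
        using relax[of G W ?R ?D ?B u v x "rmem s' 6" "imem s' 3" "rmem s' 3"] True uvx J G(1)
        by (auto simp: J_def s'_def fun_eq_iff n_def)
      then have "J t (insert (u, v, x) S) s'"
        using J by (auto simp: J_def input_state_def s'_def store_def)
      then show ?thesis unfolding W by (auto simp: s'_def)
    qed
  qed
  have loop3: "wp \<omega> (for_verts 3 ?body) (\<lambda>s' m. m \<le> n * (6 + 2) + 2 \<and>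
      (imem s' 2 0 0 = imem s 2 0 0 \<and> imem s' 2 1 0 = u \<and> imem s' 2 2 0 = v \<and> J t (S \<union> {u} \<times> {v} \<times> {..<n}) s')) s"
    if J: "J t S s" and i: "imem s 2 1 0 = u" "imem s 2 2 0 = v" and uv: "u < n" "v < n" for t S s u v
  proof (rule wp_for_verts[where I="\<lambda>x s'. imem s' 2 0 0 = imem s 2 0 0 \<and> imem s' 2 1 0 = u \<and> imem s' 2 2 0 = v
      \<and> J t (S \<union> {u} \<times> {v} \<times> {..<x}) s'"], goal_cases)
    case (1 x s')
    have eq: "S \<union> {u} \<times> {v} \<times> {..<Suc x} = insert (u, v, x) (S \<union> {u} \<times> {v} \<times> {..<x})"
      by (auto simp: less_Suc_eq)
    show ?case unfolding eq
      by (rule wp_mono[OF body[of t "S \<union> {u} \<times> {v} \<times> {..<x}" s' u v x]]) (use 1 uv in simp_all)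
  qed (use J i in \<open>auto intro: frame nv\<close>)
  have loop2: "wp \<omega> (for_verts 2 (for_verts 3 ?body)) (\<lambda>s' m. m \<le> n * ((n * 8 + 2) + 2) + 2 \<and>
      (imem s' 2 0 0 = imem s 2 0 0 \<and> imem s' 2 1 0 = u \<and> J t (S \<union> {u} \<times> {..<n} \<times> {..<n}) s')) s"
    if J: "J t S s" and i: "imem s 2 1 0 = u" and uv: "u < n" for t S s u
  proof (rule wp_for_verts[where I="\<lambda>x s'. imem s' 2 0 0 = imem s 2 0 0 \<and> imem s' 2 1 0 = u
      \<and> J t (S \<union> {u} \<times> {..<x} \<times> {..<n}) s'"], goal_cases)
    case (1 x s')
    have eq: "S \<union> {u} \<times> {..<Suc x} \<times> {..<n} = (S \<union> {u} \<times> {..<x} \<times> {..<n}) \<union> {u} \<times> {x} \<times> {..<n}"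
      by (auto simp: less_Suc_eq)
    show ?case unfolding eq
      by (rule wp_mono[OF loop3[of t "S \<union> {u} \<times> {..<x} \<times> {..<n}" s' u x]]) (use 1 uv in \<open>simp_all add: algebra_simps\<close>)
  qed (use J i in \<open>auto intro: frame nv\<close>)
  have loop1: "wp \<omega> (for_verts 1 (for_verts 2 (for_verts 3 ?body))) (\<lambda>s' m. m \<le> n * ((n * (n * 8 + 4) + 2) + 2) + 2 \<and>
      (imem s' 2 0 0 = imem s 2 0 0 \<and> J t (S \<union> {..<n} \<times> {..<n} \<times> {..<n}) s')) s"
    if J: "J t S s" for t S s
  proof (rule wp_for_verts[where I="\<lambda>x s'. imem s' 2 0 0 = imem s 2 0 0
      \<and> J t (S \<union> {..<x} \<times> {..<n} \<times> {..<n}) s'"], goal_cases)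
    case (1 x s')
    have eq: "S \<union> {..<Suc x} \<times> {..<n} \<times> {..<n} = (S \<union> {..<x} \<times> {..<n} \<times> {..<n}) \<union> {x} \<times> {..<n} \<times> {..<n}"
      by (auto simp: less_Suc_eq)
    show ?case unfolding eq
      by (rule wp_mono[OF loop2[of t "S \<union> {..<x} \<times> {..<n} \<times> {..<n}" s' x]]) (use 1 in \<open>simp_all add: algebra_simps\<close>)
  qed (use J in \<open>auto intro: frame nv\<close>)
  have "wp \<omega> find_bottlenecks (\<lambda>s' m. m \<le> n * ((n * (n * (n * 8 + 4) + 4) + 2) + 2) + 2 \<and> J n {} s') s"
    unfolding find_bottlenecks_def
  proof (rule wp_for_verts[where I="\<lambda>t s'. J t {} s'"], goal_cases)
    case (1 t s')
    show ?case
      using loop1[OF 1(2)]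
    proof (rule wp_mono, goal_cases)
      case (1 s1 m)
      \<comment> \<open>After a full round \<open>S\<close> contains all triples, so
        \<open>complete_upto\<close> advances by one vertex, and the next round starts with the
        empty set.\<close>
      then show ?case using \<open>imem s' 2 0 0 = t\<close> complete_upto_Suc[of G "Suc t" "imem s1 3" "rmem s1 6"]
        by (auto simp: J_def n_def relaxed_def algebra_simps)
    qed
  next
    case 4
    \<comment> \<open>Initially only the diagonal is flagged, with estimate 0, which is the length
      of the one-vertex path.\<close>
    have single: "q = [u] \<and> u = v" if "is_path G u v q" "length q \<le> 1" for u v q
      using that by (cases q) (auto simp: is_path_def)
    have "complete_upto G (Suc 0) (imem s 3) (rmem s 6)"
      unfolding complete_upto_def
    proof (intro allI impI)
      fix u v q assume "u < nverts G" "is_path G u v q" "length q \<le> Suc 0"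
      with single[of u v q] s show "imem s 3 u v \<noteq> 0 \<and> rmem s 6 u v \<le> path_length G q"
        by (simp add: path_length_def)
    qed
    moreover have "sound G W (imem s 3) (rmem s 6) (rmem s 3)"
      unfolding sound_def
    proof (intro allI impI)
      fix u v assume *: "u < nverts G" "v < nverts G" "imem s 3 u v \<noteq> 0"
      then have "u = v" using s(4) by fastforce
      then show "\<exists>p. is_path G u v p \<and> rmem s 6 u v = path_length G p
        \<and> (u \<noteq> v \<longrightarrow> rmem s 3 u v = Min (W ` set (path_edges p)))
        \<and> (\<forall>q r. p = q @ r \<longrightarrow> q \<noteq> [] \<longrightarrow> imem s 3 u (last q) \<noteq> 0 \<and> rmem s 6 u (last q) \<le> path_length G q)"
        using * s by (intro exI[of _ "[u]"]) (auto simp: is_path_def path_length_def Cons_eq_append_conv)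
    qed
    ultimately show ?case using s by (simp add: J_def relaxed_def)
  qed (auto intro: frame nv)
  then show ?thesis
  proof (rule wp_mono)
    fix s' m assume a: "m \<le> n * ((n * (n * (n * 8 + 4) + 4) + 2) + 2) + 2 \<and> J n {} s'"
    \<comment> \<open>Starting from one vertex, n rounds cover paths with \<open>Suc n\<close>
      vertices, more than any simple path has.\<close>
    have "rmem s' 3 u v = bottleneck G W u v" if "(u, v) \<in> vertex_pairs G" for u v
      using a that sound_complete_bottleneck[OF G(2), of W "imem s' 3" "rmem s' 6" "rmem s' 3" "Suc n" u v]
      by (auto simp: J_def vertex_pairs_def n_def)
    with a show "m \<le> n * (n * (n * (n * 8 + 4) + 4) + 4) + 2 \<and>
     (\<forall>(u, v)\<in>vertex_pairs G. rmem s' 3 u v = bottleneck G W u v)" by (auto simp: algebra_simps)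
  qed
qed

lemma private_bottlenecks_correct:
  assumes G: "wf_network G" "unique_shortest_paths G"
    and sc: "computes_scale sc \<epsilon> \<delta> \<sigma>"
  defines "n \<equiv> nverts G"
  shows "\<exists>s t. exec \<omega> (private_bottlenecks d sc) (input G w \<epsilon> \<delta>) s t
      \<and> t \<le> (n * (n * 5 + 5) + 2) + (n * (n * (n * (n * 8 + 4) + 4) + 4) + 2)"
    and "run (private_bottlenecks d sc) G w \<epsilon> \<delta> \<omega> =
      restrict (\<lambda>(u, v). bottleneck G (noisy n d \<sigma> w \<omega>) u v) (vertex_pairs G)"
proof -
  let ?N = "n * (n * 5 + 5) + 2" and ?M = "n * (n * (n * (n * 8 + 4) + 4) + 4) + 2"
  have "wp \<omega> (private_bottlenecks d sc) (\<lambda>s t. t \<le> ?N + ?M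
     \<and> (\<forall>(u, v)\<in>vertex_pairs G. rmem s 3 u v = bottleneck G (noisy n d \<sigma> w \<omega>) u v)) (input G w \<epsilon> \<delta>)"
    unfolding private_bottlenecks_def wp_Seq
    using add_noise_correct[OF G(1) sc, where w=w and \<omega>=\<omega> and d=d, folded n_def]
  proof (rule wp_mono, goal_cases)
    case (1 s t)
    show ?case
      by (rule wp_mono, rule find_bottlenecks_correct[of G w \<epsilon> \<delta> s "noisy n d \<sigma> w \<omega>", folded n_def])
        (use 1 G in \<open>auto simp: n_def\<close>)
  qed
  then obtain s t where e: "exec \<omega> (private_bottlenecks d sc) (input G w \<epsilon> \<delta>) s t" "t \<le> ?N + ?M"
    and r: "\<forall>(u, v)\<in>vertex_pairs G. rmem s 3 u v = bottleneck G (noisy n d \<sigma> w \<omega>) u v"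
    unfolding wp_def by blast
  show "\<exists>s t. exec \<omega> (private_bottlenecks d sc) (input G w \<epsilon> \<delta>) s t \<and> t \<le> ?N + ?M" using e by blast
  show "run (private_bottlenecks d sc) G w \<epsilon> \<delta> \<omega> =
      restrict (\<lambda>(u, v). bottleneck G (noisy n d \<sigma> w \<omega>) u v) (vertex_pairs G)"
    unfolding run_def final_state_eq[OF e(1)] released_def using r by (intro restrict_ext) auto
qed

section \<open>Product densities\<close>

definition noise_density :: "noise \<Rightarrow> real \<Rightarrow> real" where
  "noise_density d x = (case d of Laplace \<Rightarrow> exp (- \<bar>x\<bar>) / 2 | Gauss \<Rightarrow> std_normal_density x)"

lemma noise_density_nonneg [simp]: "0 \<le> noise_density d x"
  by (cases d) (simp_all add: noise_density_def)

lemma noise_density_measurable [measurable]: "noise_density d \<in> borel_measurable borel"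
  unfolding noise_density_def by (cases d) simp_all

lemma noise_distribution_density:
  "noise_distribution d = density lborel (\<lambda>x. ennreal (noise_density d x))"
  by (cases d) (simp_all add: noise_density_def)

lemma sets_noise_distribution [simp, measurable_cong]: "sets (noise_distribution d) = sets borel"
  by (simp add: noise_distribution_density)

lemma space_noise_distribution [simp]: "space (noise_distribution d) = UNIV"
  by (simp add: noise_distribution_density)

lemma nn_integral_noise_density: "(\<integral>\<^sup>+x. noise_density d x \<partial>lborel) = 1"
proof (cases d)
  case Laplace
  let ?E = "\<lambda>x. ennreal (exponential_density 1 x)"
  have E: "integral\<^sup>N lborel ?E = 1"
    using prob_space.emeasure_space_1[OF prob_space_exponential_density[of 1]]
    by (simp add: emeasure_density)
  \<comment> \<open>The Laplace density is the exponential density averaged with its reflection. At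
    0 both summands are 1 and the identity fails, so it is used almost everywhere.\<close>
  have "ennreal (noise_density d x) = (?E x + ?E (- x)) / 2" if "x \<noteq> 0" for x
    using that Laplace
    by (cases "x < 0") (auto simp: noise_density_def exponential_density_def ennreal_divide_numeral)
  then have "AE x in lborel. ennreal (noise_density d x) = (?E x + ?E (- x)) / 2"
    using AE_lborel_singleton[of 0] by auto
  then have "(\<integral>\<^sup>+x. noise_density d x \<partial>lborel) = (\<integral>\<^sup>+x. (?E x + ?E (- x)) / 2 \<partial>lborel)"
    by (rule nn_integral_cong_AE)
  also have "\<dots> = (integral\<^sup>N lborel ?E + (\<integral>\<^sup>+x. ?E (- x) \<partial>lborel)) / 2"
    by (simp add: nn_integral_divide nn_integral_add)
  also have "(\<integral>\<^sup>+x. ?E (- x) \<partial>lborel) = integral\<^sup>N lborel ?E"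
    using nn_integral_real_affine[of ?E "-1" 0] by simp
  also have "(integral\<^sup>N lborel ?E + integral\<^sup>N lborel ?E) / 2 = 1"
    unfolding E by (simp add: ennreal_divide_self)
  finally show ?thesis .
next
  case Gauss
  then show ?thesis
    using prob_space.emeasure_space_1[OF prob_space_normal_density[of 1 0]]
    by (simp add: emeasure_density noise_density_def)
qed

lemma nn_integral_noise_density_shift: "(\<integral>\<^sup>+x. noise_density d (x - a) \<partial>lborel) = 1"
  using nn_integral_real_affine[of "\<lambda>x. ennreal (noise_density d x)" 1 "-a"]
  by (simp add: nn_integral_noise_density)

lemma prob_space_shift: "prob_space (density lborel (\<lambda>x. ennreal (noise_density d (x - a))))"
  by (rule prob_spaceI) (simp add: emeasure_density nn_integral_noise_density_shift)

lemma prob_space_noise_distribution: "prob_space (noise_distribution d)"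
  using prob_space_shift[of d 0] by (simp add: noise_distribution_density)

text \<open>The product measure is determined by its values on boxes, and there the integral of a
  product of one-variable functions factorises. The joint density makes pointwise comparison of two
  shifted vectors possible.\<close>

lemma PiM_density:
  fixes f :: "'i \<Rightarrow> real \<Rightarrow> ennreal"
  assumes "finite I" and f[measurable]: "\<And>i. f i \<in> borel_measurable borel"
    and p: "\<And>i. prob_space (density lborel (f i))"
  shows "Pi\<^sub>M I (\<lambda>i. density lborel (f i)) = density (Pi\<^sub>M I (\<lambda>_. lborel)) (\<lambda>x. \<Prod>i\<in>I. f i (x i))"
proof -
  interpret P: product_sigma_finite "\<lambda>i. density lborel (f i)"
    by (intro product_sigma_finite.intro prob_space_imp_sigma_finite p)
  interpret L: product_sigma_finite "\<lambda>i::'i. lborel :: real measure"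
    by (intro product_sigma_finite.intro) unfold_locales
  show ?thesis
  proof (rule P.PiM_eqI[symmetric])
    fix A assume A: "\<And>i. i \<in> I \<Longrightarrow> A i \<in> sets (density lborel (f i))"
    then have [measurable]: "i \<in> I \<Longrightarrow> A i \<in> sets borel" for i by simp
    have box: "Pi\<^sub>E I A \<in> sets (Pi\<^sub>M I (\<lambda>_. lborel))"
      using \<open>finite I\<close> by (intro sets_PiM_I_finite) auto
    have "emeasure (density (Pi\<^sub>M I (\<lambda>_. lborel)) (\<lambda>x. \<Prod>i\<in>I. f i (x i))) (Pi\<^sub>E I A)
      = (\<integral>\<^sup>+x. (\<Prod>i\<in>I. f i (x i)) * indicator (Pi\<^sub>E I A) x \<partial>Pi\<^sub>M I (\<lambda>_. lborel))"
      by (intro emeasure_density box) measurable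
    also have "\<dots> = (\<integral>\<^sup>+x. (\<Prod>i\<in>I. f i (x i) * indicator (A i) (x i)) \<partial>Pi\<^sub>M I (\<lambda>_. lborel))"
    proof (rule nn_integral_cong)
      fix x assume "x \<in> space (Pi\<^sub>M I (\<lambda>_. lborel :: real measure))"
      then have "x \<in> extensional I" by (auto simp: space_PiM PiE_def)
      then have "indicator (Pi\<^sub>E I A) x = (\<Prod>i\<in>I. indicator (A i) (x i) :: ennreal)"
        using \<open>finite I\<close> by (auto simp: indicator_def PiE_iff prod_zero_iff)
      then show "(\<Prod>i\<in>I. f i (x i)) * indicator (Pi\<^sub>E I A) x = (\<Prod>i\<in>I. f i (x i) * indicator (A i) (x i))"
        by (simp add: prod.distrib)
    qed
    also have "\<dots> = (\<Prod>i\<in>I. \<integral>\<^sup>+x. f i x * indicator (A i) x \<partial>lborel)"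
      using \<open>finite I\<close> by (intro L.product_nn_integral_prod) auto
    also have "\<dots> = (\<Prod>i\<in>I. emeasure (density lborel (f i)) (A i))"
      by (intro prod.cong refl) (simp add: emeasure_density)
    finally show "emeasure (density (Pi\<^sub>M I (\<lambda>_. lborel)) (\<lambda>x. \<Prod>i\<in>I. f i (x i))) (Pi\<^sub>E I A)
      = (\<Prod>i\<in>I. emeasure (density lborel (f i)) (A i))" .
  qed (use \<open>finite I\<close> in \<open>auto intro!: sets_PiM_cong\<close>)
qed

lemma density_lborel_shift:
  assumes [measurable]: "h \<in> borel_measurable borel"
  shows "distr (density lborel h) borel ((+) a) = density lborel (\<lambda>x::real. h (x - a))"
  using density_distr[of "\<lambda>x. h (x - a)" borel "(+) a" lborel] by (simp add: lborel_distr_plus)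

section \<open>Vectors of independent shifted noise\<close>

definition shifted_noise :: "noise \<Rightarrow> 'i set \<Rightarrow> ('i \<Rightarrow> real) \<Rightarrow> ('i \<Rightarrow> real) measure" where
  "shifted_noise d I c = Pi\<^sub>M I (\<lambda>i. density lborel (\<lambda>x. ennreal (noise_density d (x - c i))))"

lemma sets_shifted_noise [simp, measurable_cong]:
  "sets (shifted_noise d I c) = sets (Pi\<^sub>M I (\<lambda>_. borel))"
  unfolding shifted_noise_def by (intro sets_PiM_cong) auto

lemma prob_space_shifted_noise: "prob_space (shifted_noise d I c)"
  unfolding shifted_noise_def by (intro prob_space_PiM prob_space_shift)

lemma shifted_noise_density:
  assumes "finite I"
  shows "shifted_noise d I c =
    density (Pi\<^sub>M I (\<lambda>_. lborel)) (\<lambda>x. ennreal (\<Prod>i\<in>I. noise_density d (x i - c i)))"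
  unfolding shifted_noise_def
  by (subst PiM_density[OF assms]) (simp_all add: prob_space_shift prod_ennreal)

text \<open>The preimage of a box under a translation is a box, which reduces the claim to one
  coordinate and the translation invariance of Lebesgue measure.\<close>

lemma distr_add_noise:
  assumes "finite I"
  shows "distr (Pi\<^sub>M I (\<lambda>_. noise_distribution d)) (Pi\<^sub>M I (\<lambda>_. borel)) (\<lambda>x. \<lambda>i\<in>I. c i + x i)
    = shifted_noise d I c"
proof -
  let ?N = "\<lambda>i. density lborel (\<lambda>x. ennreal (noise_density d (x - c i)))"
  interpret P: product_sigma_finite ?N
    by (intro product_sigma_finite.intro prob_space_imp_sigma_finite prob_space_shift)
  interpret Q: product_sigma_finite "\<lambda>i::'a. noise_distribution d"
    by (intro product_sigma_finite.intro prob_space_imp_sigma_finite prob_space_noise_distribution)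
  have [measurable]: "(\<lambda>x. \<lambda>i\<in>I. c i + x i) \<in> measurable (Pi\<^sub>M I (\<lambda>_. noise_distribution d)) (Pi\<^sub>M I (\<lambda>_. borel))"
    by measurable
  show ?thesis
    unfolding shifted_noise_def
  proof (rule P.PiM_eqI)
    fix A assume A: "\<And>i. i \<in> I \<Longrightarrow> A i \<in> sets (?N i)"
    then have A': "i \<in> I \<Longrightarrow> A i \<in> sets borel" for i by simp
    have m: "(+) a -` B \<in> sets borel" if "B \<in> sets borel" for a :: real and B
      using measurable_sets[of "(+) a" borel borel B] that by simp
    have "(\<lambda>x. \<lambda>i\<in>I. c i + x i) -` Pi\<^sub>E I A \<inter> space (Pi\<^sub>M I (\<lambda>_. noise_distribution d))
        = Pi\<^sub>E I (\<lambda>i. (+) (c i) -` A i)"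
      by (auto simp: space_PiM PiE_iff)
    then have "emeasure (distr (Pi\<^sub>M I (\<lambda>_. noise_distribution d)) (Pi\<^sub>M I (\<lambda>_. borel)) (\<lambda>x. \<lambda>i\<in>I. c i + x i)) (Pi\<^sub>E I A)
      = emeasure (Pi\<^sub>M I (\<lambda>_. noise_distribution d)) (Pi\<^sub>E I (\<lambda>i. (+) (c i) -` A i))"
      using A' assms by (subst emeasure_distr) (auto intro!: sets_PiM_I_finite)
    also have "\<dots> = (\<Prod>i\<in>I. emeasure (noise_distribution d) ((+) (c i) -` A i))"
      using A' assms by (intro Q.emeasure_PiM) (auto intro: m)
    also have "\<dots> = (\<Prod>i\<in>I. emeasure (?N i) (A i))"
    proof (intro prod.cong refl)
      fix i assume "i \<in> I"
      have "emeasure (?N i) (A i) = emeasure (distr (noise_distribution d) borel ((+) (c i))) (A i)"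
        unfolding noise_distribution_density by (subst density_lborel_shift) simp_all
      also have "\<dots> = emeasure (noise_distribution d) ((+) (c i) -` A i)"
        using A'[OF \<open>i \<in> I\<close>] by (subst emeasure_distr) auto
      finally show "emeasure (noise_distribution d) ((+) (c i) -` A i) = emeasure (?N i) (A i)" ..
    qed
    finally show "emeasure (distr (Pi\<^sub>M I (\<lambda>_. noise_distribution d)) (Pi\<^sub>M I (\<lambda>_. borel)) (\<lambda>x. \<lambda>i\<in>I. c i + x i)) (Pi\<^sub>E I A)
      = (\<Prod>i\<in>I. emeasure (?N i) (A i))" .
  qed (use assms in \<open>auto intro!: sets_PiM_cong\<close>)
qed

section \<open>Privacy of additive noise\<close>

text \<open>Turns a pointwise comparison of densities into a privacy guarantee: the mass of the
  remainder \<open>r\<close> becomes the additive \<delta>. Laplace noise needs no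
  remainder.\<close>

lemma emeasure_density_le:
  assumes [measurable]: "p \<in> borel_measurable M" "q \<in> borel_measurable M" "r \<in> borel_measurable M"
    and le: "\<And>x. x \<in> space M \<Longrightarrow> p x \<le> a * q x + r x" and r: "integral\<^sup>N M r \<le> b"
    and C[measurable]: "C \<in> sets M"
  shows "emeasure (density M p) C \<le> a * emeasure (density M q) C + (b :: ennreal)"
proof -
  have "emeasure (density M p) C = (\<integral>\<^sup>+x. p x * indicator C x \<partial>M)"
    by (simp add: emeasure_density)
  also have "\<dots> \<le> (\<integral>\<^sup>+x. a * (q x * indicator C x) + r x \<partial>M)"
  proof (rule nn_integral_mono)
    fix x assume "x \<in> space M"
    then show "p x * indicator C x \<le> a * (q x * indicator C x) + r x"
      using le[of x] by (cases "x \<in> C") auto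
  qed
  also have "\<dots> = a * emeasure (density M q) C + integral\<^sup>N M r"
    by (simp add: emeasure_density nn_integral_add nn_integral_cmult)
  also have "\<dots> \<le> a * emeasure (density M q) C + b" using r by (intro add_left_mono)
  finally show ?thesis .
qed

text \<open>By the triangle inequality the density ratio in coordinate \<open>i\<close> is at most
  the exponential of \<open>\<bar>a i - b i\<bar>\<close>, and the exponents add up over the
  coordinates.\<close>

lemma laplace_mechanism:
  assumes "finite I" and s: "(\<Sum>i\<in>I. \<bar>a i - b i\<bar>) \<le> \<epsilon>" and C: "C \<in> sets (Pi\<^sub>M I (\<lambda>_. borel))"
  shows "measure (shifted_noise Laplace I a) C \<le> exp \<epsilon> * measure (shifted_noise Laplace I b) C"
proof -
  interpret A: prob_space "shifted_noise Laplace I a" by (rule prob_space_shifted_noise)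
  interpret B: prob_space "shifted_noise Laplace I b" by (rule prob_space_shifted_noise)
  let ?p = "\<lambda>c x. \<Prod>i\<in>I. noise_density Laplace (x i - c i)"
  have C': "C \<in> sets (Pi\<^sub>M I (\<lambda>_. lborel))"
    using C by (simp cong: sets_PiM_cong)
  have le: "?p a x \<le> exp \<epsilon> * ?p b x" for x
  proof -
    have "?p a x \<le> (\<Prod>i\<in>I. exp \<bar>a i - b i\<bar> * noise_density Laplace (x i - b i))"
    proof (intro prod_mono conjI noise_density_nonneg)
      fix i assume "i \<in> I"
      have "exp (- \<bar>x i - a i\<bar>) \<le> exp \<bar>a i - b i\<bar> * exp (- \<bar>x i - b i\<bar>)"
        unfolding exp_add[symmetric] by (subst exp_le_cancel_iff) linarith
      then show "noise_density Laplace (x i - a i) \<le> exp \<bar>a i - b i\<bar> * noise_density Laplace (x i - b i)"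
        by (simp add: noise_density_def)
    qed
    also have "\<dots> = exp (\<Sum>i\<in>I. \<bar>a i - b i\<bar>) * ?p b x"
      by (simp add: prod.distrib exp_sum[OF assms(1)])
    also have "\<dots> \<le> exp \<epsilon> * ?p b x" using s by (intro mult_right_mono prod_nonneg) auto
    finally show ?thesis .
  qed
  have "emeasure (shifted_noise Laplace I a) C \<le> ennreal (exp \<epsilon>) * emeasure (shifted_noise Laplace I b) C + 0"
    unfolding shifted_noise_density[OF assms(1)]
  proof (rule emeasure_density_le[where r="\<lambda>_. 0"])
    show "ennreal (?p a x) \<le> ennreal (exp \<epsilon>) * ennreal (?p b x) + 0" for x
      using le[of x] by (simp add: ennreal_mult[symmetric] prod_nonneg ennreal_leI)
  qed (use C' in auto)
  then show ?thesis
    unfolding A.emeasure_eq_measure B.emeasure_eq_measure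
    by (simp add: ennreal_mult[symmetric])
qed

text \<open>With \<open>\<lambda> = \<epsilon> / s\<close>, where \<open>s\<close> bounds the squared distance of the shifts, the mass where the
  privacy loss exceeds \<open>\<epsilon>\<close> is at most \<open>\<integral> p (p / (q e\<^sup>\<epsilon>))\<^sup>\<lambda>\<close>; completing the square, \<open>p\<^sup>1\<^sup>+\<^sup>\<lambda> q\<^sup>-\<^sup>\<lambda>\<close> is a
  constant times another shifted normal density.\<close>

lemma gauss_mechanism:
  assumes "finite I" and s: "(\<Sum>i\<in>I. (a i - b i)\<^sup>2) \<le> s" and pos: "0 < s" "0 < \<delta>"
    and \<delta>: "\<epsilon> / 2 - \<epsilon>\<^sup>2 / (2 * s) \<le> ln \<delta>" "0 < \<epsilon>"
    and C: "C \<in> sets (Pi\<^sub>M I (\<lambda>_. borel))"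
  shows "measure (shifted_noise Gauss I a) C \<le> exp \<epsilon> * measure (shifted_noise Gauss I b) C + \<delta>"
proof -
  interpret A: prob_space "shifted_noise Gauss I a" by (rule prob_space_shifted_noise)
  interpret B: prob_space "shifted_noise Gauss I b" by (rule prob_space_shifted_noise)
  \<comment> \<open>The exponent \<open>l * (1 + l) / 2 * s - l * \<epsilon>\<close> is minimal at
    \<open>l = \<epsilon> / s - 1 / 2\<close>. The choice \<open>\<epsilon> / s\<close> is always
    positive and costs only an extra \<open>s / 8\<close>.\<close>
  define l where "l = \<epsilon> / s"
  have l: "0 < l" using pos \<delta> by (simp add: l_def)
  \<comment> \<open>The centre obtained by completing the square in \<open>(1 + l)\<close> times the
    exponent at \<open>a\<close> minus \<open>l\<close> times the exponent at \<open>b\<close>. The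
    remainder \<open>r\<close> is \<delta> times the density centred there, so its mass is exactly
    \<delta>.\<close>
  define m where "m i = (1 + l) * a i - l * b i" for i
  let ?p = "\<lambda>c x. \<Prod>i\<in>I. noise_density Gauss (x i - c i)"
  let ?K = "(1 / sqrt (2 * pi)) ^ card I"
  let ?e = "\<lambda>c x. (\<Sum>i\<in>I. - (x i - c i)\<^sup>2 / 2)"
  have p: "?p c x = ?K * exp (?e c x)" for c x :: "'a \<Rightarrow> real"
  proof -
    have "noise_density Gauss y = 1 / sqrt (2 * pi) * exp (- y\<^sup>2 / 2)" for y
      by (simp add: noise_density_def normal_density_def)
    then show ?thesis by (simp only: prod.distrib prod_constant exp_sum[OF assms(1)])
  qed
  define r where "r x = \<delta> * ?p m x" for x
  have C': "C \<in> sets (Pi\<^sub>M I (\<lambda>_. lborel))"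
    using C by (simp cong: sets_PiM_cong)
  have le: "?p a x \<le> exp \<epsilon> * ?p b x + r x" for x
  proof (cases "?e a x - ?e b x \<le> \<epsilon>")
    case True
    then have "exp (?e a x) \<le> exp (\<epsilon> + ?e b x)" by (subst exp_le_cancel_iff) linarith
    then have "?p a x \<le> exp \<epsilon> * ?p b x"
      unfolding p by (simp add: exp_add mult_left_mono mult.left_commute)
    moreover have "0 \<le> r x" using pos by (auto simp: r_def intro!: mult_nonneg_nonneg prod_nonneg)
    ultimately show ?thesis by simp
  next
    case False
    \<comment> \<open>The completed square. Where the loss exceeds \<epsilon>, adding
      \<open>l\<close> times the loss minus \<epsilon> only increases the exponent, which bounds the
      density at \<open>a\<close> by \<open>r\<close>.\<close>
    have "?e m x + l * (1 + l) / 2 * (\<Sum>i\<in>I. (a i - b i)\<^sup>2) = ?e a x + l * (?e a x - ?e b x)"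
      unfolding sum_distrib_left sum_subtractf[symmetric] sum.distrib[symmetric]
      by (intro sum.cong refl) (simp add: m_def field_simps power2_eq_square)
    moreover have "l * (1 + l) / 2 * (\<Sum>i\<in>I. (a i - b i)\<^sup>2) \<le> l * (1 + l) / 2 * s"
      using s l by (intro mult_left_mono) auto
    moreover have "l * (1 + l) / 2 * s - l * \<epsilon> = \<epsilon> / 2 - \<epsilon>\<^sup>2 / (2 * s)"
      using pos by (simp add: l_def field_simps power2_eq_square)
    moreover have "l * \<epsilon> \<le> l * (?e a x - ?e b x)" using False l by (intro mult_left_mono) auto
    ultimately have "?e a x \<le> ln \<delta> + ?e m x" using \<delta>(1) by linarith
    then have "exp (?e a x) \<le> exp (ln \<delta> + ?e m x)" by (subst exp_le_cancel_iff)
    then have "?p a x \<le> r x"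
      unfolding r_def p using pos by (simp add: exp_add mult_left_mono mult.left_commute)
    moreover have "0 \<le> exp \<epsilon> * ?p b x" by (intro mult_nonneg_nonneg prod_nonneg) auto
    ultimately show ?thesis by simp
  qed
  have r0: "0 \<le> r x" for x using pos by (auto simp: r_def intro!: mult_nonneg_nonneg prod_nonneg)
  have "emeasure (shifted_noise Gauss I a) C \<le> ennreal (exp \<epsilon>) * emeasure (shifted_noise Gauss I b) C + ennreal \<delta>"
    unfolding shifted_noise_density[OF assms(1)]
  proof (rule emeasure_density_le[where r="\<lambda>x. ennreal (r x)"])
    show "ennreal (?p a x) \<le> ennreal (exp \<epsilon>) * ennreal (?p b x) + ennreal (r x)" for x
      using le[of x] r0[of x]
      by (simp add: ennreal_mult[symmetric] ennreal_plus[symmetric] prod_nonneg ennreal_leI del: ennreal_plus)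
    have "(\<integral>\<^sup>+x. ennreal (?p m x) \<partial>Pi\<^sub>M I (\<lambda>_. lborel)) = emeasure (shifted_noise Gauss I m) (space (shifted_noise Gauss I m))"
      unfolding shifted_noise_density[OF assms(1)] by (subst emeasure_density) (auto cong: nn_integral_cong)
    then have "(\<integral>\<^sup>+x. ennreal (?p m x) \<partial>Pi\<^sub>M I (\<lambda>_. lborel)) = 1"
      using prob_space.emeasure_space_1[OF prob_space_shifted_noise[of Gauss I m]] by simp
    then show "(\<integral>\<^sup>+x. ennreal (r x) \<partial>Pi\<^sub>M I (\<lambda>_. lborel)) \<le> ennreal \<delta>"
      using pos by (simp add: r_def ennreal_mult prod_nonneg nn_integral_cmult)
  qed (use C' in \<open>auto simp: r_def\<close>)
  then show ?thesis
    unfolding A.emeasure_eq_measure B.emeasure_eq_measure using pos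
    by (simp add: ennreal_mult[symmetric] ennreal_plus[symmetric] del: ennreal_plus)
qed

section \<open>Tails\<close>

text \<open>No tail integral is computed: beyond \<open>t\<close> the density is dominated by
  \<open>b\<close> times the sum of its two translates, each of total mass 1.\<close>

lemma noise_tail:
  assumes t: "0 \<le> t"
    and le: "\<And>x. t < \<bar>x\<bar> \<Longrightarrow> noise_density d x \<le> b * (noise_density d (x - t) + noise_density d (x + t))"
    and b: "0 \<le> b"
  shows "measure (noise_distribution d) {x. t < \<bar>x\<bar>} \<le> 2 * b"
proof -
  interpret prob_space "noise_distribution d" by (rule prob_space_noise_distribution)
  have "emeasure (noise_distribution d) {x. t < \<bar>x\<bar>}
      = (\<integral>\<^sup>+x. ennreal (noise_density d x) * indicator {x. t < \<bar>x\<bar>} x \<partial>lborel)"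
    unfolding noise_distribution_density by (subst emeasure_density) auto
  also have "\<dots> \<le> (\<integral>\<^sup>+x. ennreal b * (ennreal (noise_density d (x - t)) + ennreal (noise_density d (x - (- t)))) \<partial>lborel)"
    using le b by (intro nn_integral_mono)
      (auto simp: ennreal_mult[symmetric] ennreal_plus[symmetric] ennreal_leI split: split_indicator simp del: ennreal_plus)
  also have "\<dots> = ennreal b * (1 + 1)"
    by (simp add: nn_integral_cmult nn_integral_add nn_integral_noise_density_shift del: diff_minus_eq_add)
  also have "\<dots> = ennreal (2 * b)"
    using b ennreal_mult[of 2 b] by (simp add: mult.commute)
  finally show ?thesis using b by (simp add: emeasure_eq_measure)
qed

text \<open>Outside the interval from -t to t, moving by \<open>t\<close> towards 0 shortens
  \<open>\<bar>x\<bar>\<close> by exactly \<open>t\<close>.\<close>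

lemma laplace_tail: "0 \<le> t \<Longrightarrow> measure (noise_distribution Laplace) {x. t < \<bar>x\<bar>} \<le> 2 * exp (- t)"
proof (rule noise_tail)
  fix x :: real assume t: "0 \<le> t" "t < \<bar>x\<bar>"
  have "exp (- \<bar>x\<bar>) = exp (- t) * exp (- \<bar>x - t\<bar>) \<or> exp (- \<bar>x\<bar>) = exp (- t) * exp (- \<bar>x + t\<bar>)"
    using t unfolding exp_add[symmetric] by (cases "0 < x") auto
  then show "noise_density Laplace x \<le> exp (- t) * (noise_density Laplace (x - t) + noise_density Laplace (x + t))"
    by (auto simp: noise_density_def algebra_simps)
qed auto

text \<open>With \<open>u\<close> equal to \<open>t\<close> or \<open>- t\<close> according to the
  sign of \<open>x\<close>, the difference x^2 - t^2 - (x - u)^2 is 2 (x u - t^2), which is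
  nonnegative beyond \<open>t\<close>.\<close>

lemma gauss_tail: "0 \<le> t \<Longrightarrow> measure (noise_distribution Gauss) {x. t < \<bar>x\<bar>} \<le> 2 * exp (- t\<^sup>2 / 2)"
proof (rule noise_tail)
  fix x :: real assume t: "0 \<le> t" "t < \<bar>x\<bar>"
  let ?f = "noise_density Gauss"
  have shift: "?f x \<le> exp (- t\<^sup>2 / 2) * ?f (x - u)" if "u\<^sup>2 = t\<^sup>2" "t\<^sup>2 \<le> x * u" for u
  proof -
    have "- x\<^sup>2 / 2 \<le> - t\<^sup>2 / 2 + - (x - u)\<^sup>2 / 2" using that by (simp add: power2_eq_square algebra_simps)
    then have "exp (- x\<^sup>2 / 2) \<le> exp (- t\<^sup>2 / 2) * exp (- (x - u)\<^sup>2 / 2)"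
      unfolding exp_add[symmetric] by (subst exp_le_cancel_iff)
    then show ?thesis
      by (simp add: noise_density_def normal_density_def divide_right_mono)
  qed
  have "?f x \<le> exp (- t\<^sup>2 / 2) * ?f (x - t) \<or> ?f x \<le> exp (- t\<^sup>2 / 2) * ?f (x - (- t))"
  proof (cases "0 < x")
    case True
    then show ?thesis using t by (intro disjI1 shift) (auto simp: power2_eq_square mult_right_mono)
  next
    case False
    then have "t * t \<le> (- x) * t" using t by (intro mult_right_mono) auto
    then show ?thesis using t by (intro disjI2 shift) (auto simp: power2_eq_square)
  qed
  moreover have "0 \<le> exp (- t\<^sup>2 / 2) * ?f (x - t)" "0 \<le> exp (- t\<^sup>2 / 2) * ?f (x + t)" by simp_all
  ultimately show "?f x \<le> exp (- t\<^sup>2 / 2) * (?f (x - t) + ?f (x + t))"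
    unfolding distrib_left diff_minus_eq_add by linarith
qed auto

section \<open>The noise tape\<close>

lemma noise_tape_eq: "noise_tape = Pi\<^sub>M UNIV (\<lambda>k. noise_distribution (fst k))"
  unfolding noise_tape_def by (intro PiM_cong) auto

lemma prob_space_noise_tape: "prob_space noise_tape"
  unfolding noise_tape_eq by (intro prob_space_PiM prob_space_noise_distribution)

lemma tape_measurable [measurable]: "(\<lambda>\<omega>. \<omega> k) \<in> borel_measurable noise_tape"
proof -
  have "(\<lambda>\<omega>. \<omega> k) \<in> measurable noise_tape (noise_distribution (fst k))"
    unfolding noise_tape_eq by (rule measurable_component_singleton) simp
  then show ?thesis using measurable_cong_sets[OF refl sets_noise_distribution] by blast
qed

text \<open>Injectivity ensures that distinct indices read distinct cells of the tape, hence
  independent values.\<close>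

lemma distr_noise_tape:
  assumes "inj_on f I"
  shows "distr noise_tape (Pi\<^sub>M I (\<lambda>_. borel)) (\<lambda>\<omega>. \<lambda>i\<in>I. \<omega> (d, f i)) = Pi\<^sub>M I (\<lambda>_. noise_distribution d)"
proof -
  have "distr noise_tape (Pi\<^sub>M I (\<lambda>_. borel)) (\<lambda>\<omega>. \<lambda>i\<in>I. \<omega> (d, f i)) =
    distr noise_tape (Pi\<^sub>M I (\<lambda>i. noise_distribution (fst (d, f i)))) (\<lambda>\<omega>. \<lambda>i\<in>I. \<omega> (d, f i))"
    by (intro distr_cong sets_PiM_cong) auto
  also have "\<dots> = Pi\<^sub>M I (\<lambda>i. noise_distribution (fst (d, f i)))"
    unfolding noise_tape_eq
    using assms by (intro distr_PiM_reindex[where f="\<lambda>i. (d, f i)"] prob_space_noise_distribution) (auto simp: inj_on_def)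
  finally show ?thesis by simp
qed

lemma noise_tape_marginal:
  assumes [measurable]: "A \<in> sets borel"
  shows "measure noise_tape {\<omega> \<in> space noise_tape. \<omega> (d, k) \<in> A} = measure (noise_distribution d) A"
proof -
  have "distr noise_tape (noise_distribution d) (\<lambda>\<omega>. \<omega> (d, k)) = noise_distribution d"
    unfolding noise_tape_eq
    using distr_PiM_component[of UNIV "\<lambda>k. noise_distribution (fst k)" "(d, k)"] prob_space_noise_distribution
    by simp
  then have "measure (noise_distribution d) A = measure (distr noise_tape (noise_distribution d) (\<lambda>\<omega>. \<omega> (d, k))) A"
    by simp
  also have "\<dots> = measure noise_tape ((\<lambda>\<omega>. \<omega> (d, k)) -` A \<inter> space noise_tape)"
    by (rule measure_distr) simp_all
  finally show ?thesis by (simp add: vimage_def Int_def conj_commute)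
qed

lemma noise_tape_union_bound:
  fixes b :: real
  assumes I: "finite I" and tail: "measure (noise_distribution d) {x. t < \<bar>x\<bar>} \<le> b"
  shows "1 - card I * b \<le> measure noise_tape {\<omega> \<in> space noise_tape. \<forall>i\<in>I. \<bar>\<omega> (d, f i)\<bar> \<le> t}"
proof -
  interpret prob_space noise_tape by (rule prob_space_noise_tape)
  let ?B = "\<lambda>i. {\<omega> \<in> space noise_tape. \<omega> (d, f i) \<in> {x. t < \<bar>x\<bar>}}"
  have B: "?B i \<in> sets noise_tape" for i by measurable
  have "prob (\<Union>i\<in>I. ?B i) \<le> (\<Sum>i\<in>I. prob (?B i))"
    using I B by (intro finite_measure_subadditive_finite) auto
  also have "\<dots> \<le> (\<Sum>i\<in>I. b)" using tail by (intro sum_mono, subst noise_tape_marginal) auto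
  finally have "prob (\<Union>i\<in>I. ?B i) \<le> card I * b" by simp
  have "{\<omega> \<in> space noise_tape. \<forall>i\<in>I. \<bar>\<omega> (d, f i)\<bar> \<le> t} = space noise_tape - (\<Union>i\<in>I. ?B i)"
    (is "?A = _") by (auto simp: not_less)
  moreover have "prob (space noise_tape - (\<Union>i\<in>I. ?B i)) = 1 - prob (\<Union>i\<in>I. ?B i)"
    using I B by (intro prob_compl sets.finite_UN) auto
  ultimately have "prob ?A = 1 - prob (\<Union>i\<in>I. ?B i)" by (simp only:)
  with \<open>prob (\<Union>i\<in>I. ?B i) \<le> card I * b\<close> show ?thesis by linarith
qed

section \<open>The noisy bottlenecks\<close>

lemma finite_edges: "wf_network G \<Longrightarrow> finite (edges G)"
  by (rule finite_subset[of _ "Pow {..<nverts G}"]) (auto simp: wf_network_def)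

lemma card_edges_le:
  assumes "wf_network G"
  shows "card (edges G) \<le> nverts G * nverts G"
proof -
  have "edges G \<subseteq> (\<lambda>(u, v). {u, v}) ` ({..<nverts G} \<times> {..<nverts G})"
    using assms by (auto simp: wf_network_def)
  then have "card (edges G) \<le> card ({..<nverts G} \<times> {..<nverts G})"
    by (rule surj_card_le[rotated]) simp
  then show ?thesis by simp
qed

text \<open>Since the smaller end is below n, division by n with remainder recovers both ends. This
  is what makes the noise on different edges independent.\<close>

lemma inj_on_draw_index:
  assumes "wf_network G"
  shows "inj_on (draw_index (nverts G)) (edges G)"
proof (rule inj_onI)
  let ?n = "nverts G"
  have e: "e = {Max e, Min e} \<and> Min e < ?n" if "e \<in> edges G" for e
  proof -
    from that assms obtain u v where "e = {u, v}" "u < ?n" "v < ?n"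
      unfolding wf_network_def by blast
    then show ?thesis by (cases "u \<le> v") (auto simp: max_def min_def)
  qed
  fix e f assume ef: "e \<in> edges G" "f \<in> edges G" and eq: "draw_index ?n e = draw_index ?n f"
  have "Max e = Max f" "Min e = Min f"
    using e[OF ef(1)] e[OF ef(2)] arg_cong[OF eq, of "\<lambda>k. k div ?n"] arg_cong[OF eq, of "\<lambda>k. k mod ?n"]
    by (simp_all add: draw_index_def)
  with e[OF ef(1)] e[OF ef(2)] show "e = f" by metis
qed

lemma bottleneck_cong:
  assumes "unique_shortest_paths G" "(u, v) \<in> vertex_pairs G" "\<And>e. e \<in> edges G \<Longrightarrow> w e = w' e"
  shows "bottleneck G w u v = bottleneck G w' u v"
  unfolding bottleneck_def
  using shortest_path_edges(1)[OF assms(1,2)] assms(3) by (intro arg_cong[where f=Min] image_cong) auto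

lemma bottleneck_lipschitz:
  assumes G: "unique_shortest_paths G" "(u, v) \<in> vertex_pairs G"
    and le: "\<And>e. e \<in> edges G \<Longrightarrow> \<bar>w e - w' e\<bar> \<le> b"
  shows "\<bar>bottleneck G w u v - bottleneck G w' u v\<bar> \<le> b"
proof -
  let ?P = "set (path_edges (shortest_path G u v))"
  have ne: "?P \<noteq> {}" and sub: "?P \<subseteq> edges G" using shortest_path_edges[OF G] by auto
  have "Min (f ` ?P) - b \<le> Min (g ` ?P)" if "\<And>e. e \<in> ?P \<Longrightarrow> f e - b \<le> g e" for f g :: "nat set \<Rightarrow> real"
  proof -
    have "Min (f ` ?P) - b \<le> g e" if "e \<in> ?P" for e
    proof -
      have "Min (f ` ?P) \<le> f e" using that by (intro Min_le) auto
      with \<open>\<And>e. e \<in> ?P \<Longrightarrow> f e - b \<le> g e\<close>[OF that] show ?thesis by linarith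
    qed
    then show ?thesis using ne by (intro Min.boundedI) auto
  qed
  from this[of w w'] this[of w' w] show ?thesis
    unfolding bottleneck_def using le sub by (fastforce simp: abs_le_iff)
qed

text \<open>The post-processing of the noisy vector, given in units of \<sigma>. It does not mention
  the private attributes, so privacy of the vector passes to the output.\<close>

definition scaled_bottlenecks :: "network \<Rightarrow> real \<Rightarrow> (nat set \<Rightarrow> real) \<Rightarrow> nat \<times> nat \<Rightarrow> real" where
  "scaled_bottlenecks G \<sigma> y = restrict (\<lambda>(u, v). bottleneck G (\<lambda>e. \<sigma> * y e) u v) (vertex_pairs G)"

lemma scaled_bottlenecks_measurable:
  assumes G: "unique_shortest_paths G"
  shows "scaled_bottlenecks G \<sigma> \<in> measurable (Pi\<^sub>M (edges G) (\<lambda>_. borel)) (output_space G)"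
  unfolding scaled_bottlenecks_def output_space_def
proof (rule measurable_restrict)
  fix uv assume uv: "uv \<in> vertex_pairs G"
  obtain u v where "uv = (u, v)" by (cases uv)
  have "(\<lambda>y. Min ((\<lambda>e. \<sigma> * y e) ` set (path_edges (shortest_path G u v))))
      \<in> borel_measurable (Pi\<^sub>M (edges G) (\<lambda>_. borel))"
    using shortest_path_edges(1)[OF G, of u v] uv \<open>uv = (u, v)\<close>
    by (intro borel_measurable_Min borel_measurable_times measurable_component_singleton) auto
  then show "(\<lambda>y. case uv of (u, v) \<Rightarrow> bottleneck G (\<lambda>e. \<sigma> * y e) u v)
      \<in> borel_measurable (Pi\<^sub>M (edges G) (\<lambda>_. borel))"
    by (simp add: \<open>uv = (u, v)\<close> bottleneck_def)
qed

lemma finite_vertex_pairs: "finite (vertex_pairs G)"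
  by (rule finite_subset[of _ "{..<nverts G} \<times> {..<nverts G}"]) (auto simp: vertex_pairs_def)

text \<open>Working in units of \<open>\<sigma>\<close>, the attributes only shift the standard noise.\<close>

lemma run_eq_scaled:
  fixes w :: "nat set \<Rightarrow> real"
  assumes G: "wf_network G" "unique_shortest_paths G"
    and scale: "computes_scale sc \<epsilon> \<delta> \<sigma>" and "\<sigma> \<noteq> 0"
  shows "run (private_bottlenecks d sc) G w \<epsilon> \<delta> \<omega> = scaled_bottlenecks G \<sigma>
    (\<lambda>e\<in>edges G. w e / \<sigma> + \<omega> (d, draw_index (nverts G) e))"
  unfolding private_bottlenecks_correct(2)[OF G scale] scaled_bottlenecks_def
  using \<open>\<sigma> \<noteq> 0\<close>
  by (intro restrict_ext)
    (auto intro!: bottleneck_cong[OF G(2)] simp: noisy_def draw_index_def field_simps)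

lemma run_measurable:
  fixes w :: "nat set \<Rightarrow> real"
  assumes G: "wf_network G" "unique_shortest_paths G"
    and scale: "computes_scale sc \<epsilon> \<delta> \<sigma>" and "\<sigma> \<noteq> 0"
  shows "run (private_bottlenecks d sc) G w \<epsilon> \<delta> \<in> measurable noise_tape (output_space G)"
  unfolding run_eq_scaled[OF assms]
  by (rule measurable_compose[OF _ scaled_bottlenecks_measurable[OF G(2)]]) measurable

lemma mechanism_eq:
  fixes w :: "nat set \<Rightarrow> real"
  assumes G: "wf_network G" "unique_shortest_paths G"
    and scale: "computes_scale sc \<epsilon> \<delta> \<sigma>" and "\<sigma> \<noteq> 0"
  shows "mechanism (private_bottlenecks d sc) G \<epsilon> \<delta> w =
    distr (shifted_noise d (edges G) (\<lambda>e. w e / \<sigma>)) (output_space G) (scaled_bottlenecks G \<sigma>)"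
proof -
  let ?E = "edges G" and ?B = "Pi\<^sub>M (edges G) (\<lambda>_. borel :: real measure)"
  let ?X = "\<lambda>\<omega>. \<lambda>e\<in>?E. \<omega> (d, draw_index (nverts G) e)"
  let ?S = "\<lambda>x. \<lambda>e\<in>?E. w e / \<sigma> + x e"
  note fin = finite_edges[OF G(1)]
  note [measurable] = scaled_bottlenecks_measurable[OF G(2), of \<sigma>]
  have [measurable]: "?X \<in> measurable noise_tape ?B" "?S \<in> measurable ?B ?B" by measurable
  have "shifted_noise d ?E (\<lambda>e. w e / \<sigma>) = distr (Pi\<^sub>M ?E (\<lambda>_. noise_distribution d)) ?B ?S"
    by (rule distr_add_noise[OF fin, symmetric])
  also have "Pi\<^sub>M ?E (\<lambda>_. noise_distribution d) = distr noise_tape ?B ?X"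
    by (rule distr_noise_tape[OF inj_on_draw_index[OF G(1)], symmetric])
  also have "distr (distr noise_tape ?B ?X) ?B ?S = distr noise_tape ?B (?S \<circ> ?X)"
    by (rule distr_distr) measurable
  finally have "shifted_noise d ?E (\<lambda>e. w e / \<sigma>) = distr noise_tape ?B (?S \<circ> ?X)" .
  then have "distr (shifted_noise d ?E (\<lambda>e. w e / \<sigma>)) (output_space G) (scaled_bottlenecks G \<sigma>)
    = distr noise_tape (output_space G) (scaled_bottlenecks G \<sigma> \<circ> (?S \<circ> ?X))"
    by (simp add: distr_distr)
  also have "scaled_bottlenecks G \<sigma> \<circ> (?S \<circ> ?X) = run (private_bottlenecks d sc) G w \<epsilon> \<delta>"
    by (rule ext) (simp add: run_eq_scaled[OF assms] cong: restrict_cong)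
  finally show ?thesis by (simp add: mechanism_def)
qed

section \<open>Efficiency, privacy and accuracy for a general noise and scale\<close>

lemma efficient_private_bottlenecks:
  assumes G: "\<And>G w \<epsilon> \<delta>. (G, w, \<epsilon>, \<delta>) \<in> I \<Longrightarrow> wf_network G \<and> unique_shortest_paths G"
    and scale: "\<And>G w \<epsilon> \<delta>. (G, w, \<epsilon>, \<delta>) \<in> I \<Longrightarrow> computes_scale sc \<epsilon> \<delta> (\<sigma> \<epsilon> \<delta>)"
    and pos: "\<And>G w \<epsilon> \<delta>. (G, w, \<epsilon>, \<delta>) \<in> I \<Longrightarrow> \<sigma> \<epsilon> \<delta> \<noteq> 0"
  shows "efficient_algorithm (private_bottlenecks d sc) I"
proof -
  \<comment> \<open>The sum of the step bounds of \<open>add_noise\<close> and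
    \<open>find_bottlenecks\<close>, constant coefficient first.\<close>
  let ?p = "[:4, 9, 9, 4, 8:] :: nat poly"
  have "\<exists>s t. exec \<omega> (private_bottlenecks d sc) (input G w \<epsilon> \<delta>) s t \<and> t \<le> poly ?p (nverts G)"
    if "(G, w, \<epsilon>, \<delta>) \<in> I" for G w \<epsilon> \<delta> \<omega>
  proof -
    have "poly ?p n = (n * (n * 5 + 5) + 2) + (n * (n * (n * (n * 8 + 4) + 4) + 4) + 2)" for n
      by (simp add: algebra_simps)
    then show ?thesis using private_bottlenecks_correct(1) G[OF that] scale[OF that] by metis
  qed
  moreover have "run (private_bottlenecks d sc) G w \<epsilon> \<delta> \<in> measurable noise_tape (output_space G)"
    if "(G, w, \<epsilon>, \<delta>) \<in> I" for G w \<epsilon> \<delta>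
    using G[OF that] scale[OF that] pos[OF that] by (intro run_measurable) auto
  ultimately show ?thesis unfolding efficient_algorithm_def by blast
qed

text \<open>The preimage \<open>?C\<close> of an output event is the same for both attribute
  functions, so \<open>dp\<close> applies to it directly.\<close>

lemma private_bottlenecks_dp:
  assumes G: "wf_network G" "unique_shortest_paths G"
    and scale: "computes_scale sc \<epsilon> \<delta> \<sigma>" and "\<sigma> \<noteq> 0"
    and dp: "\<And>w w' C. neighboring G w w' \<Longrightarrow> C \<in> sets (Pi\<^sub>M (edges G) (\<lambda>_. borel)) \<Longrightarrow>
      measure (shifted_noise d (edges G) (\<lambda>e. w e / \<sigma>)) C
        \<le> exp \<epsilon> * measure (shifted_noise d (edges G) (\<lambda>e. w' e / \<sigma>)) C + \<delta>"
  shows "differentially_private \<epsilon> \<delta> X (neighboring G) (mechanism (private_bottlenecks d sc) G \<epsilon> \<delta>)"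
  unfolding differentially_private_def
proof (intro ballI impI)
  fix w w' C assume nb: "neighboring G w w'"
    and "C \<in> sets (mechanism (private_bottlenecks d sc) G \<epsilon> \<delta> w)"
  then have C: "C \<in> sets (output_space G)" by (simp add: mechanism_def)
  note T[measurable] = scaled_bottlenecks_measurable[OF G(2), of \<sigma>]
  let ?C = "scaled_bottlenecks G \<sigma> -` C \<inter> space (Pi\<^sub>M (edges G) (\<lambda>_. borel))"
  have "measure (mechanism (private_bottlenecks d sc) G \<epsilon> \<delta> w) C
      = measure (shifted_noise d (edges G) (\<lambda>e. w e / \<sigma>)) ?C" for w
    unfolding mechanism_eq[OF G scale \<open>\<sigma> \<noteq> 0\<close>] using C T
    by (subst measure_distr) (simp_all add: sets_eq_imp_space_eq[OF sets_shifted_noise])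
  then show "measure (mechanism (private_bottlenecks d sc) G \<epsilon> \<delta> w) C
      \<le> exp \<epsilon> * measure (mechanism (private_bottlenecks d sc) G \<epsilon> \<delta> w') C + \<delta>"
    using dp[OF nb measurable_sets[OF T C]] by simp
qed

text \<open>The factor 4 in \<open>tail\<close> makes the failure probability at most 2 / n^4 per
  edge. Over at most n^2 edges this gives 2 / n^2, which is at most 1 / n once n is at least
  2.\<close>

lemma private_bottlenecks_accurate:
  fixes w :: "nat set \<Rightarrow> real"
  assumes G: "wf_network G" "unique_shortest_paths G"
    and scale: "computes_scale sc \<epsilon> \<delta> \<sigma>" and "0 < \<sigma>"
    and tail: "measure (noise_distribution d) {x. t < \<bar>x\<bar>} \<le> 2 * exp (- (4 * ln (nverts G)))"
    and b: "\<sigma> * t \<le> b"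
  shows "accurate b G w (mechanism (private_bottlenecks d sc) G \<epsilon> \<delta> w)"
proof (cases "nverts G = 1")
  \<comment> \<open>For a single vertex the required probability is 0.\<close>
  case True
  then show ?thesis by (simp add: accurate_def)
next
  case False
  let ?n = "nverts G" and ?c = "private_bottlenecks d sc"
  let ?P = "\<lambda>f. \<forall>(u, v)\<in>vertex_pairs G. \<bar>f (u, v) - bottleneck G w u v\<bar> \<le> b"
  interpret prob_space noise_tape by (rule prob_space_noise_tape)
  have rm: "run ?c G w \<epsilon> \<delta> \<in> measurable noise_tape (output_space G)"
    using \<open>0 < \<sigma>\<close> by (intro run_measurable[OF G scale]) simp
  have S: "{f \<in> space (output_space G). ?P f} \<in> sets (output_space G)"
    using finite_vertex_pairs[of G] unfolding output_space_def case_prod_beta prod.collapse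
    by measurable
  have pre: "{\<omega> \<in> space noise_tape. ?P (run ?c G w \<epsilon> \<delta> \<omega>)}
      = run ?c G w \<epsilon> \<delta> -` {f \<in> space (output_space G). ?P f} \<inter> space noise_tape"
    using measurable_space[OF rm] by auto
  have n: "2 \<le> ?n" using G(1) False by (simp add: wf_network_def)
  have "exp (- (4 * ln (real ?n))) = 1 / real ?n ^ 4"
    using n by (simp add: exp_minus exp_of_nat_mult[of 4, simplified] divide_inverse)
  then have "card (edges G) * (2 * exp (- (4 * ln (real ?n)))) \<le> (real ?n * real ?n) * (2 * (1 / real ?n ^ 4))"
    using card_edges_le[OF G(1)] by (intro mult_mono) (auto simp flip: of_nat_mult)
  also have "\<dots> = (2 / real ?n) * (1 / real ?n)" using n by (simp add: field_simps power4_eq_xxxx)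
  also have "\<dots> \<le> 1 * (1 / real ?n)" using n by (intro mult_right_mono) auto
  finally have "1 - 1 / real ?n \<le> 1 - card (edges G) * (2 * exp (- (4 * ln (real ?n))))" by simp
  also have "\<dots> \<le> prob {\<omega> \<in> space noise_tape. \<forall>e\<in>edges G. \<bar>\<omega> (d, draw_index ?n e)\<bar> \<le> t}"
    by (rule noise_tape_union_bound[OF finite_edges[OF G(1)] tail])
  also have "\<dots> \<le> prob {\<omega> \<in> space noise_tape. ?P (run ?c G w \<epsilon> \<delta> \<omega>)}"
  proof (rule finite_measure_mono)
    show "{\<omega> \<in> space noise_tape. ?P (run ?c G w \<epsilon> \<delta> \<omega>)} \<in> events"
      unfolding pre by (rule measurable_sets[OF rm S])
    show "{\<omega> \<in> space noise_tape. \<forall>e\<in>edges G. \<bar>\<omega> (d, draw_index ?n e)\<bar> \<le> t}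
        \<subseteq> {\<omega> \<in> space noise_tape. ?P (run ?c G w \<epsilon> \<delta> \<omega>)}"
    proof (clarify)
      fix \<omega> u v assume le: "\<forall>e\<in>edges G. \<bar>\<omega> (d, draw_index ?n e)\<bar> \<le> t" and uv: "(u, v) \<in> vertex_pairs G"
      have "\<bar>noisy ?n d \<sigma> w \<omega> e - w e\<bar> \<le> b" if "e \<in> edges G" for e
      proof -
        have "\<bar>noisy ?n d \<sigma> w \<omega> e - w e\<bar> = \<sigma> * \<bar>\<omega> (d, draw_index ?n e)\<bar>"
          using \<open>0 < \<sigma>\<close> by (simp add: noisy_def draw_index_def abs_mult)
        also have "\<dots> \<le> \<sigma> * t" using le that \<open>0 < \<sigma>\<close> by (intro mult_left_mono) auto
        finally show ?thesis using b by linarith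
      qed
      then have "\<bar>bottleneck G (noisy ?n d \<sigma> w \<omega>) u v - bottleneck G w u v\<bar> \<le> b"
        by (rule bottleneck_lipschitz[OF G(2) uv])
      then show "\<bar>run ?c G w \<epsilon> \<delta> \<omega> (u, v) - bottleneck G w u v\<bar> \<le> b"
        unfolding private_bottlenecks_correct(2)[OF G scale] using uv by simp
    qed
  qed
  also have "\<dots> = measure (mechanism ?c G \<epsilon> \<delta> w) {f \<in> space (mechanism ?c G \<epsilon> \<delta> w). ?P f}"
    unfolding pre mechanism_def using measure_distr[OF rm S] by simp
  finally show ?thesis unfolding accurate_def .
qed

section \<open>Noise scales and constants of the two algorithms\<close>

theorem theorem5p1:
  shows
    "(\<exists>c. efficient_algorithm c
          {(G, w, \<epsilon>, \<delta>). wf_network G \<and> unique_shortest_paths G \<and> w \<in> attributes G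
             \<and> 0 < \<epsilon> \<and> \<epsilon> < 1 \<and> \<delta> = 0}
        \<and> (\<forall>G \<epsilon>. wf_network G \<and> unique_shortest_paths G \<and> 0 < \<epsilon> \<and> \<epsilon> < 1 \<longrightarrow>
             differentially_private \<epsilon> 0 (attributes G) (neighboring G) (mechanism c G \<epsilon> 0))
        \<and> (\<exists>K. \<forall>G \<epsilon> w. wf_network G \<and> unique_shortest_paths G \<and> 0 < \<epsilon> \<and> \<epsilon> < 1
             \<and> w \<in> attributes G \<longrightarrow>
             accurate (K * (ln (real (nverts G)) / \<epsilon>)) G w (mechanism c G \<epsilon> 0 w)))
     \<and>
     (\<exists>c. efficient_algorithm c
          {(G, w, \<epsilon>, \<delta>). wf_network G \<and> unique_shortest_paths G \<and> w \<in> attributes G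
             \<and> 0 < \<epsilon> \<and> \<epsilon> < 1 \<and> 0 < \<delta> \<and> \<delta> < 1}
        \<and> (\<forall>G \<epsilon> \<delta>. wf_network G \<and> unique_shortest_paths G \<and> 0 < \<epsilon> \<and> \<epsilon> < 1
             \<and> 0 < \<delta> \<and> \<delta> < 1 \<longrightarrow>
             differentially_private \<epsilon> \<delta> (attributes G) (neighboring G) (mechanism c G \<epsilon> \<delta>))
        \<and> (\<forall>\<delta>0<1. \<exists>K. \<forall>G \<epsilon> \<delta> w. wf_network G \<and> unique_shortest_paths G \<and> 0 < \<epsilon> \<and> \<epsilon> < 1
             \<and> 0 < \<delta> \<and> \<delta> \<le> \<delta>0 \<and> w \<in> attributes G \<longrightarrow>
             accurate (K * (sqrt (ln (real (nverts G)) * ln (1 / \<delta>)) / \<epsilon>)) G w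
               (mechanism c G \<epsilon> \<delta> w)))"
proof (intro conjI)
  let ?eps = "RRead 2 (IConst 0) (IConst 0)" and ?del = "RRead 2 (IConst 0) (IConst 1)"
  let ?lap = "RDiv (RConst 1) ?eps"
  \<comment> \<open>With \<open>s = 1 / \<sigma>\<^sup>2\<close> this scale turns the exponent in
    \<open>gauss_mechanism\<close> into \<epsilon> / 2 - 1 / 2 - ln (1 / \<delta>), which is at most
    ln \<delta> because \<epsilon> < 1.\<close>
  let ?gau = "RDiv (RSqrt (RAdd (RConst 1) (RMul (RConst 2) (RLn (RDiv (RConst 1) ?del))))) ?eps"
  let ?\<sigma> = "\<lambda>\<epsilon> \<delta>. sqrt (1 + 2 * ln (1 / \<delta>)) / \<epsilon>"
  have lap: "computes_scale ?lap \<epsilon> \<delta> (1 / \<epsilon>)" for \<epsilon> \<delta>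
    by (simp add: computes_scale_def)
  have gau: "computes_scale ?gau \<epsilon> \<delta> (?\<sigma> \<epsilon> \<delta>)" for \<epsilon> \<delta>
    by (simp add: computes_scale_def)
  have \<sigma>: "0 < ?\<sigma> \<epsilon> \<delta>" if "0 < \<epsilon>" "0 < \<delta>" "\<delta> < 1" for \<epsilon> \<delta> :: real
  proof (intro divide_pos_pos iffD2[OF real_sqrt_gt_0_iff])
    have "0 \<le> ln (1 / \<delta>)" using that by (intro ln_ge_zero) auto
    then show "0 < 1 + 2 * ln (1 / \<delta>)" by linarith
  qed (rule that)
  show "\<exists>c. efficient_algorithm c
          {(G, w, \<epsilon>, \<delta>). wf_network G \<and> unique_shortest_paths G \<and> w \<in> attributes G
             \<and> 0 < \<epsilon> \<and> \<epsilon> < 1 \<and> \<delta> = 0}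
        \<and> (\<forall>G \<epsilon>. wf_network G \<and> unique_shortest_paths G \<and> 0 < \<epsilon> \<and> \<epsilon> < 1 \<longrightarrow>
             differentially_private \<epsilon> 0 (attributes G) (neighboring G) (mechanism c G \<epsilon> 0))
        \<and> (\<exists>K. \<forall>G \<epsilon> w. wf_network G \<and> unique_shortest_paths G \<and> 0 < \<epsilon> \<and> \<epsilon> < 1
             \<and> w \<in> attributes G \<longrightarrow>
             accurate (K * (ln (real (nverts G)) / \<epsilon>)) G w (mechanism c G \<epsilon> 0 w))"
  \<comment> \<open>The constant 4 comes from the threshold 4 ln n for standard Laplace noise,
    multiplied by the scale 1 / \<epsilon>.\<close>
  proof (intro exI[of _ "private_bottlenecks Laplace ?lap"] exI[of _ 4] conjI allI impI; (elim conjE)?)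
    show "efficient_algorithm (private_bottlenecks Laplace ?lap)
          {(G, w, \<epsilon>, \<delta>). wf_network G \<and> unique_shortest_paths G \<and> w \<in> attributes G
             \<and> 0 < \<epsilon> \<and> \<epsilon> < 1 \<and> \<delta> = 0}"
      by (rule efficient_private_bottlenecks[OF _ lap]) auto
  next
    fix G and \<epsilon> :: real assume G: "wf_network G" "unique_shortest_paths G" and e: "0 < \<epsilon>"
    show "differentially_private \<epsilon> 0 (attributes G) (neighboring G) (mechanism (private_bottlenecks Laplace ?lap) G \<epsilon> 0)"
    proof (rule private_bottlenecks_dp[OF G lap])
      fix w w' :: "nat set \<Rightarrow> real" and C :: "(nat set \<Rightarrow> real) set"
      assume nb: "neighboring G w w'" and C: "C \<in> sets (Pi\<^sub>M (edges G) (\<lambda>_. borel))"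
      have "(\<Sum>e\<in>edges G. \<bar>w e / (1 / \<epsilon>) - w' e / (1 / \<epsilon>)\<bar>) = \<epsilon> * (\<Sum>e\<in>edges G. \<bar>w e - w' e\<bar>)"
        using e by (simp add: sum_distrib_left abs_mult flip: left_diff_distrib) (simp add: mult.commute)
      also have "\<dots> \<le> \<epsilon>" using nb e by (simp add: neighboring_def)
      finally show "measure (shifted_noise Laplace (edges G) (\<lambda>e. w e / (1 / \<epsilon>))) C
        \<le> exp \<epsilon> * measure (shifted_noise Laplace (edges G) (\<lambda>e. w' e / (1 / \<epsilon>))) C + 0"
        using laplace_mechanism[OF finite_edges[OF G(1)] _ C] by simp
    qed (use e in auto)
  next
    fix G w and \<epsilon> :: real assume G: "wf_network G" "unique_shortest_paths G" and e: "0 < \<epsilon>"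
    show "accurate (4 * (ln (real (nverts G)) / \<epsilon>)) G w (mechanism (private_bottlenecks Laplace ?lap) G \<epsilon> 0 w)"
    proof (rule private_bottlenecks_accurate[OF G lap])
      have "0 \<le> ln (real (nverts G))" using G(1) by (simp add: wf_network_def)
      then show "measure (noise_distribution Laplace) {x. 4 * ln (real (nverts G)) < \<bar>x\<bar>} \<le> 2 * exp (- (4 * ln (nverts G)))"
        by (intro laplace_tail) auto
    qed (use e in auto)
  qed
  show "\<exists>c. efficient_algorithm c
          {(G, w, \<epsilon>, \<delta>). wf_network G \<and> unique_shortest_paths G \<and> w \<in> attributes G
             \<and> 0 < \<epsilon> \<and> \<epsilon> < 1 \<and> 0 < \<delta> \<and> \<delta> < 1}
        \<and> (\<forall>G \<epsilon> \<delta>. wf_network G \<and> unique_shortest_paths G \<and> 0 < \<epsilon> \<and> \<epsilon> < 1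
             \<and> 0 < \<delta> \<and> \<delta> < 1 \<longrightarrow>
             differentially_private \<epsilon> \<delta> (attributes G) (neighboring G) (mechanism c G \<epsilon> \<delta>))
        \<and> (\<forall>\<delta>0<1. \<exists>K. \<forall>G \<epsilon> \<delta> w. wf_network G \<and> unique_shortest_paths G \<and> 0 < \<epsilon> \<and> \<epsilon> < 1
             \<and> 0 < \<delta> \<and> \<delta> \<le> \<delta>0 \<and> w \<in> attributes G \<longrightarrow>
             accurate (K * (sqrt (ln (real (nverts G)) * ln (1 / \<delta>)) / \<epsilon>)) G w
               (mechanism c G \<epsilon> \<delta> w))"
  proof (intro exI[of _ "private_bottlenecks Gauss ?gau"] conjI allI impI; (elim conjE)?)
    show "efficient_algorithm (private_bottlenecks Gauss ?gau)
          {(G, w, \<epsilon>, \<delta>). wf_network G \<and> unique_shortest_paths G \<and> w \<in> attributes G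
             \<and> 0 < \<epsilon> \<and> \<epsilon> < 1 \<and> 0 < \<delta> \<and> \<delta> < 1}"
    proof (rule efficient_private_bottlenecks[OF _ gau])
      fix G w and \<epsilon> \<delta> :: real
      assume "(G, w, \<epsilon>, \<delta>) \<in> {(G, w, \<epsilon>, \<delta>). wf_network G \<and> unique_shortest_paths G \<and> w \<in> attributes G
             \<and> 0 < \<epsilon> \<and> \<epsilon> < 1 \<and> 0 < \<delta> \<and> \<delta> < 1}"
      then show "?\<sigma> \<epsilon> \<delta> \<noteq> 0" using \<sigma>[of \<epsilon> \<delta>] by auto
    qed auto
  next
    fix G and \<epsilon> \<delta> :: real assume G: "wf_network G" "unique_shortest_paths G"
      and e: "0 < \<epsilon>" "\<epsilon> < 1" and d: "0 < \<delta>" "\<delta> < 1"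
    note s = \<sigma>[OF e(1) d]
    have s2: "(?\<sigma> \<epsilon> \<delta>)\<^sup>2 = (1 + 2 * ln (1 / \<delta>)) / \<epsilon>\<^sup>2"
      using d by (simp add: power_divide)
    show "differentially_private \<epsilon> \<delta> (attributes G) (neighboring G) (mechanism (private_bottlenecks Gauss ?gau) G \<epsilon> \<delta>)"
    proof (rule private_bottlenecks_dp[OF G gau])
      fix w w' :: "nat set \<Rightarrow> real" and C :: "(nat set \<Rightarrow> real) set"
      assume nb: "neighboring G w w'" and C: "C \<in> sets (Pi\<^sub>M (edges G) (\<lambda>_. borel))"
      have "(\<Sum>e\<in>edges G. (w e / ?\<sigma> \<epsilon> \<delta> - w' e / ?\<sigma> \<epsilon> \<delta>)\<^sup>2)
          = (\<Sum>e\<in>edges G. (w e - w' e)\<^sup>2) / (?\<sigma> \<epsilon> \<delta>)\<^sup>2"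
        by (simp only: sum_divide_distrib power_divide diff_divide_distrib[symmetric])
      \<comment> \<open>Each single difference is at most 1 in absolute value, so squaring does not
        enlarge it.\<close>
      also have "(\<Sum>e\<in>edges G. (w e - w' e)\<^sup>2) \<le> (\<Sum>e\<in>edges G. \<bar>w e - w' e\<bar>)"
      proof (rule sum_mono)
        fix e assume "e \<in> edges G"
        then have "\<bar>w e - w' e\<bar> \<le> (\<Sum>e\<in>edges G. \<bar>w e - w' e\<bar>)"
          using finite_edges[OF G(1)] by (intro member_le_sum) auto
        then have "\<bar>w e - w' e\<bar> \<le> 1" using nb by (simp add: neighboring_def)
        then have "\<bar>w e - w' e\<bar> * \<bar>w e - w' e\<bar> \<le> \<bar>w e - w' e\<bar> * 1" by (intro mult_left_mono) auto
        then show "(w e - w' e)\<^sup>2 \<le> \<bar>w e - w' e\<bar>" by (simp add: power2_eq_square flip: abs_mult)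
      qed
      also have "(\<Sum>e\<in>edges G. \<bar>w e - w' e\<bar>) \<le> 1" using nb by (simp add: neighboring_def)
      finally have sq: "(\<Sum>e\<in>edges G. (w e / ?\<sigma> \<epsilon> \<delta> - w' e / ?\<sigma> \<epsilon> \<delta>)\<^sup>2) \<le> 1 / (?\<sigma> \<epsilon> \<delta>)\<^sup>2"
        using s by (simp add: divide_right_mono)
      show "measure (shifted_noise Gauss (edges G) (\<lambda>e. w e / ?\<sigma> \<epsilon> \<delta>)) C
        \<le> exp \<epsilon> * measure (shifted_noise Gauss (edges G) (\<lambda>e. w' e / ?\<sigma> \<epsilon> \<delta>)) C + \<delta>"
      proof (rule gauss_mechanism[OF finite_edges[OF G(1)] sq])
        have "\<epsilon>\<^sup>2 / (2 * (1 / (?\<sigma> \<epsilon> \<delta>)\<^sup>2)) = 1 / 2 + ln (1 / \<delta>)"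
          unfolding s2 using e by (simp add: field_simps)
        moreover have "ln (1 / \<delta>) = - ln \<delta>" using d by (simp add: ln_div)
        ultimately show "\<epsilon> / 2 - \<epsilon>\<^sup>2 / (2 * (1 / (?\<sigma> \<epsilon> \<delta>)\<^sup>2)) \<le> ln \<delta>"
          using e by linarith
      qed (use s e d C in auto)
    qed (use s in auto)
  next
    fix \<delta>0 :: real assume "\<delta>0 < 1"
    \<comment> \<open>The 8 comes from the threshold below. The additive 1 in the squared scale is
      at most ln (1 / \<delta>) / ln (1 / \<delta>0), which gives the factor 2 + 1 / ln (1 /
      \<delta>0).\<close>
    let ?K = "sqrt (8 * (2 + 1 / ln (1 / \<delta>0)))"
    show "\<exists>K. \<forall>G \<epsilon> \<delta> w. wf_network G \<and> unique_shortest_paths G \<and> 0 < \<epsilon> \<and> \<epsilon> < 1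
             \<and> 0 < \<delta> \<and> \<delta> \<le> \<delta>0 \<and> w \<in> attributes G \<longrightarrow>
             accurate (K * (sqrt (ln (real (nverts G)) * ln (1 / \<delta>)) / \<epsilon>)) G w
               (mechanism (private_bottlenecks Gauss ?gau) G \<epsilon> \<delta> w)"
    proof (intro exI[of _ ?K] allI impI; elim conjE)
      fix G w and \<epsilon> \<delta> :: real assume G: "wf_network G" "unique_shortest_paths G"
        and e: "0 < \<epsilon>" and d: "0 < \<delta>" "\<delta> \<le> \<delta>0"
      have n: "0 \<le> ln (real (nverts G))" using G(1) by (simp add: wf_network_def)
      have d0: "0 < ln (1 / \<delta>0)" "ln (1 / \<delta>0) \<le> ln (1 / \<delta>)"
        using d \<open>\<delta>0 < 1\<close> by (auto simp: ln_div)
      then have "1 \<le> (1 / ln (1 / \<delta>0)) * ln (1 / \<delta>)" by (simp add: field_simps)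
      then have "1 + 2 * ln (1 / \<delta>) \<le> (2 + 1 / ln (1 / \<delta>0)) * ln (1 / \<delta>)"
        by (simp add: algebra_simps)
      then have "(1 + 2 * ln (1 / \<delta>)) * (8 * ln (real (nverts G))) \<le> (2 + 1 / ln (1 / \<delta>0)) * ln (1 / \<delta>) * (8 * ln (real (nverts G)))"
        using n by (intro mult_right_mono) auto
      then have le: "?\<sigma> \<epsilon> \<delta> * sqrt (8 * ln (real (nverts G))) \<le> ?K * (sqrt (ln (real (nverts G)) * ln (1 / \<delta>)) / \<epsilon>)"
        using e by (simp add: divide_right_mono mult_ac flip: real_sqrt_mult)
      show "accurate (?K * (sqrt (ln (real (nverts G)) * ln (1 / \<delta>)) / \<epsilon>)) G w
               (mechanism (private_bottlenecks Gauss ?gau) G \<epsilon> \<delta> w)"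
      proof (rule private_bottlenecks_accurate[OF G gau _ _ le])
        \<comment> \<open>The threshold is chosen so that half its square is 4 ln n.\<close>
        show "measure (noise_distribution Gauss) {x. sqrt (8 * ln (real (nverts G))) < \<bar>x\<bar>} \<le> 2 * exp (- (4 * ln (nverts G)))"
          using gauss_tail[of "sqrt (8 * ln (real (nverts G)))"] n by simp
      qed (use \<sigma> e d \<open>\<delta>0 < 1\<close> in auto)
    qed
  qed
qed

end
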